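(* Let $E \subset \mathbb{H}$ be a closed $3$-regular set satisfying the local symmetry condition. Then for every $\epsilon > 0$ the estimate $$\int_{0}^{R} \mathcal{H}^{3}(\{p \in E\cap B(p_{0},R) : \beta_{E}(p,r) \geq \epsilon\}) \, \frac{dr}{r} \leq C R^{3}$$ holds for all $p_{0} \in E$ and $R > 0$, where the constant $C \geq 1$ depends only on $\epsilon$, the constants $(C_\tau)_{\tau>0}$ in the local symmetry condition, and the $3$-regularity constant of $E$.
   Context: The first Heisenberg group is $\mathbb{H} = (\mathbb{R}^{3},\cdot)$ with group law $(x,y,t)\cdot(x',y',t') = (x+x',y+y',t+t'+\tfrac12(xy'-yx'))$. Put $\|(x,y,t)\| = ((x^2+y^2)^2+16t^2)^{1/4}$ and $d(p,q) = \|q^{-1}\cdot p\|$, a metric on $\mathbb{H}$. $B(p,r)$ denotes the open $d$-ball, and Hausdorff measures $\mathcal{H}^s$, diameters and distances are taken with respect to $d$. An $\mathcal{H}^{3}$-measurable set $E \subset \mathbb{H}$ is $3$-regular if there is a constant $A \geq 1$ (the $3$-regularity constant) such that $r^{3}/A \leq \mathcal{H}^{3}(E \cap B(p,r)) \leq A r^{3}$ for all $p \in E$ and $0 < r \leq \operatorname{diam}(E)$. Let $\pi(x,y,t) = (x,y)$. For $p,q \in \mathbb{H}$ the symmetric point of $q$ relative to $p$ is $\Sigma_p(q) = q\cdot(2\pi(p)-2\pi(q),0)$. For $\tau>0$, a closed set $E$ is $\tau$-symmetric in a ball $B(p,r)$ if for all $q_1,q_2 \in E\cap B(p,r)$ there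 exists $q_1' \in E\cap B(q_1,r\tau)$ such that $\operatorname{dist}(\Sigma_{q_1'}(q_2),E) \leq \tau r$. A closed $3$-regular set $E$ satisfies the local symmetry condition if for every $\tau>0$ there is a constant $C_\tau>0$ such that for all $p_0 \in E$ and $R>0$, $$\int_0^R \mathcal{H}^3(\{p \in E\cap B(p_0,R) : E \text{ is not } \tau\text{-symmetric in } B(p,r)\})\,\frac{dr}{r} \leq C_\tau R^3.$$ A vertical plane is a (left) translate of a $2$-dimensional linear plane in $\mathbb{R}^3$ containing the $t$-axis. The vertical $\beta$-number is $\beta_E(p,r) = \inf_{\mathbb{W}} \sup_{y \in B(p,r)\cap E} d(y,\mathbb{W})/r$, where the infimum is over all vertical planes $\mathbb{W}$ and $d(y,\mathbb{W})$ is the distance from $y$ to $\mathbb{W}$. *)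

theory Defs
  imports "HOL-Analysis.Analysis"
begin

section \<open>The first Heisenberg group\<close>

text \<open>
  A separate type over \<open>\<real>\<^sup>3\<close>, because the product type already carries the Euclidean metric.
  On \<open>heis\<close> the class operations \<open>dist\<close>, \<open>ball\<close>, \<open>closed\<close>, \<open>diameter\<close> and \<open>infdist\<close>
  all refer to the Koranyi metric.
\<close>

datatype heis = Heis (coords: "real \<times> real \<times> real")

lemma heis_cases [case_names Heis, cases type: heis]:
  obtains x y t where "p = Heis (x, y, t)"
  by (metis heis.exhaust prod_cases3)

instantiation heis :: "{monoid_mult, inverse}"
begin

fun times_heis :: "heis \<Rightarrow> heis \<Rightarrow> heis" where
  "Heis (x, y, t) * Heis (x', y', t') =
     Heis (x + x', y + y', t + t' + 1/2 * (x * y' - y * x'))"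

definition one_heis :: heis where
  "1 = Heis (0, 0, 0)"

fun inverse_heis :: "heis \<Rightarrow> heis" where
  "inverse (Heis (x, y, t)) = Heis (- x, - y, - t)"

definition divide_heis :: "heis \<Rightarrow> heis \<Rightarrow> heis" where
  "p div q = p * inverse q" for p q :: heis

instance
proof
  fix a b c :: heis
  show "a * b * c = a * (b * c)"
    by (cases a; cases b; cases c) (simp add: field_simps)
  show "1 * a = a" "a * 1 = a"
    by (cases a; simp add: one_heis_def)+
qed

end

text \<open>There is no type class for multiplicatively written groups; these are the missing laws.\<close>

lemma heis_left_inverse: "inverse p * p = 1" for p :: heis
  by (cases p) (simp add: one_heis_def)

lemma heis_right_inverse: "p * inverse p = 1" for p :: heis
  by (cases p) (simp add: one_heis_def)

lemma heis_inverse_mult: "inverse (p * q) = inverse q * inverse p" for p q :: heis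
  by (cases p; cases q) (simp add: field_simps)

lemma heis_inverse_inverse: "inverse (inverse p) = p" for p :: heis
  by (cases p) simp

fun heis_norm :: "heis \<Rightarrow> real" where
  "heis_norm (Heis (x, y, t)) = root 4 ((x\<^sup>2 + y\<^sup>2)\<^sup>2 + 16 * t\<^sup>2)"

lemma heis_norm_nonneg: "heis_norm p \<ge> 0"
  by (cases p) simp

lemma heis_norm_eq_0_iff: "heis_norm p = 0 \<longleftrightarrow> p = 1"
proof (cases p)
  case (Heis x y t)
  have "(x\<^sup>2 + y\<^sup>2)\<^sup>2 + 16 * t\<^sup>2 = 0 \<longleftrightarrow> x = 0 \<and> y = 0 \<and> t = 0"
    by (auto simp: add_nonneg_eq_0_iff)
  then show ?thesis
    by (simp add: Heis one_heis_def)
qed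

lemma heis_norm_inverse: "heis_norm (inverse p) = heis_norm p"
  by (cases p) simp

text \<open>The triangle inequality is read off from \<open>\<parallel>(z, t)\<parallel>\<^sup>2 = \<bar>\<bar>z\<bar>\<^sup>2 + 4 i t\<bar>\<close> with \<open>z = x + i y\<close>.\<close>

lemma heis_norm_power2: "(heis_norm (Heis (x, y, t)))\<^sup>2 = cmod (Complex (x\<^sup>2 + y\<^sup>2) (4 * t))"
proof -
  let ?a = "(x\<^sup>2 + y\<^sup>2)\<^sup>2 + 16 * t\<^sup>2"
  have "((root 4 ?a)\<^sup>2)\<^sup>2 = root 4 ?a ^ 4"
    by simp
  also have "\<dots> = ?a"
    by (rule real_root_pow_pos2) auto
  finally have "(root 4 ?a)\<^sup>2 = sqrt ?a"
    by (metis real_sqrt_unique zero_le_power2)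
  then show ?thesis
    by (simp add: cmod_def power_mult_distrib)
qed

lemma heis_norm_triangle: "heis_norm (p * q) \<le> heis_norm p + heis_norm q"
proof (cases p; cases q)
  fix x y t x' y' t'
  assume p: "p = Heis (x, y, t)" and q: "q = Heis (x', y', t')"
  let ?z = "Complex x y" and ?w = "Complex x' y'"
  let ?a = "Complex (x\<^sup>2 + y\<^sup>2) (4 * t)" and ?b = "Complex (x'\<^sup>2 + y'\<^sup>2) (4 * t')"
  have le: "cmod (Complex u v) \<le> heis_norm (Heis (u, v, s))" for u v s
  proof -
    have "(cmod (Complex u v))\<^sup>2 = \<bar>Re (Complex (u\<^sup>2 + v\<^sup>2) (4 * s))\<bar>"
      by (simp add: cmod_power2)
    also have "\<dots> \<le> (heis_norm (Heis (u, v, s)))\<^sup>2"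
      unfolding heis_norm_power2 by (rule abs_Re_le_cmod)
    finally show ?thesis
      by (rule power2_le_imp_le) (rule heis_norm_nonneg)
  qed
  have "(heis_norm (p * q))\<^sup>2 = cmod (?a + ?b + 2 * (cnj ?z * ?w))"
    unfolding p q times_heis.simps heis_norm_power2
    by (rule arg_cong[where f = cmod])
      (simp add: complex_eq_iff power2_eq_square field_simps)
  also have "\<dots> \<le> cmod ?a + cmod ?b + cmod (2 * (cnj ?z * ?w))"
    by (intro order_trans[OF norm_triangle_ineq] add_right_mono norm_triangle_ineq)
  also have "cmod (2 * (cnj ?z * ?w)) = 2 * (cmod ?z * cmod ?w)"
    by (simp add: norm_mult)
  also have "cmod ?a + cmod ?b + 2 * (cmod ?z * cmod ?w)
      \<le> (heis_norm p)\<^sup>2 + (heis_norm q)\<^sup>2 + 2 * (heis_norm p * heis_norm q)"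
    unfolding p q heis_norm_power2
    by (intro add_left_mono mult_left_mono mult_mono le heis_norm_nonneg norm_ge_zero) simp
  also have "\<dots> = (heis_norm p + heis_norm q)\<^sup>2"
    by (simp add: power2_sum)
  finally show ?thesis
    by (rule power2_le_imp_le) (simp add: heis_norm_nonneg)
qed

instantiation heis :: metric_space
begin

definition dist_heis :: "heis \<Rightarrow> heis \<Rightarrow> real" where
  "dist p q = heis_norm (inverse q * p)"

definition uniformity_heis :: "(heis \<times> heis) filter" where
  "uniformity = (INF e\<in>{0<..}. principal {(p, q :: heis). dist p q < e})"

definition open_heis :: "heis set \<Rightarrow> bool" where
  "open U \<longleftrightarrow> (\<forall>p\<in>U. \<forall>\<^sub>F (p', q) in uniformity. p' = p \<longrightarrow> q \<in> U)" for U :: "heis set"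

instance
proof
  have sym: "dist p q = dist q p" for p q :: heis
    unfolding dist_heis_def
    by (metis heis_norm_inverse heis_inverse_mult heis_inverse_inverse)
  fix p q r :: heis
  have "dist p q = 0 \<longleftrightarrow> inverse q * p = 1"
    by (simp add: dist_heis_def heis_norm_eq_0_iff)
  also have "\<dots> \<longleftrightarrow> p = q"
    by (metis heis_left_inverse heis_right_inverse mult.assoc mult_1_left mult_1_right)
  finally show "dist p q = 0 \<longleftrightarrow> p = q" .
  have "inverse q * p = (inverse q * r) * (inverse r * p)"
    by (metis heis_right_inverse mult.assoc mult_1_left)
  then have "dist p q \<le> dist r q + dist p r"
    unfolding dist_heis_def by (simp only: heis_norm_triangle)
  then show "dist p q \<le> dist p r + dist q r"
    by (simp add: sym)
qed (simp_all only: uniformity_heis_def open_heis_def)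

end


section \<open>Hausdorff measure\<close>

text \<open>
  The Hausdorff outer measure of dimension \<open>s > 0\<close>, without a normalising factor. The
  boundedness requirement is needed because \<open>diameter\<close> is a junk value on unbounded sets. The
  empty set is an admissible covering set with \<open>0 powr s = 0\<close>, so finite covers are included;
  for \<open>s = 0\<close> the definition would be wrong since \<open>0 powr 0 = 0\<close>.
\<close>

definition hausdorff_content :: "real \<Rightarrow> real \<Rightarrow> 'a::metric_space set \<Rightarrow> ennreal" where
  "hausdorff_content s \<delta> A =
     (INF U \<in> {U :: nat \<Rightarrow> 'a set. A \<subseteq> (\<Union>i. U i) \<and> (\<forall>i. bounded (U i) \<and> diameter (U i) \<le> \<delta>)}.
        \<Sum>i. ennreal (diameter (U i) powr s))"

definition hausdorff_measure :: "real \<Rightarrow> 'a::metric_space set \<Rightarrow> ennreal" where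
  "hausdorff_measure s A = (SUP \<delta>\<in>{0<..}. hausdorff_content s \<delta> A)"

text \<open>Measurability in the sense of Caratheodory.\<close>

definition hausdorff_measurable :: "real \<Rightarrow> 'a::metric_space set \<Rightarrow> bool" where
  "hausdorff_measurable s A \<longleftrightarrow> A \<in> lambda_system UNIV (Pow UNIV) (hausdorff_measure s)"


section \<open>Regularity, symmetry and vertical beta-numbers\<close>

text \<open>For unbounded \<open>E\<close> one has \<open>diam E = \<infinity>\<close>, hence no upper bound on \<open>r\<close>.\<close>

definition three_regular :: "real \<Rightarrow> heis set \<Rightarrow> bool" where
  "three_regular A E \<longleftrightarrow>
     A \<ge> 1 \<and> hausdorff_measurable 3 E \<and>
     (\<forall>p\<in>E. \<forall>r>0. (bounded E \<longrightarrow> r \<le> diameter E) \<longrightarrow>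
        ennreal (r ^ 3 / A) \<le> hausdorff_measure 3 (E \<inter> ball p r) \<and>
        hausdorff_measure 3 (E \<inter> ball p r) \<le> ennreal (A * r ^ 3))"

fun heis_proj :: "heis \<Rightarrow> real \<times> real" where
  "heis_proj (Heis (x, y, t)) = (x, y)"

definition symmetric_point :: "heis \<Rightarrow> heis \<Rightarrow> heis" where
  "symmetric_point p q =
     (let v = 2 *\<^sub>R heis_proj p - 2 *\<^sub>R heis_proj q in q * Heis (fst v, snd v, 0))"

definition symmetric_in_ball :: "real \<Rightarrow> heis set \<Rightarrow> heis \<Rightarrow> real \<Rightarrow> bool" where
  "symmetric_in_ball \<tau> E p r \<longleftrightarrow>
     (\<forall>q\<^sub>1 \<in> E \<inter> ball p r. \<forall>q\<^sub>2 \<in> E \<inter> ball p r.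
        \<exists>q\<^sub>1' \<in> E \<inter> ball q\<^sub>1 (r * \<tau>). infdist (symmetric_point q\<^sub>1' q\<^sub>2) E \<le> \<tau> * r)"

text \<open>
  The family of constants \<open>c\<close> is a parameter, since the constant in the theorem may depend on it;
  the qualitative condition is \<open>\<exists>c. local_symmetry c E\<close>.
\<close>

definition local_symmetry :: "(real \<Rightarrow> real) \<Rightarrow> heis set \<Rightarrow> bool" where
  "local_symmetry c E \<longleftrightarrow>
     (\<forall>\<tau>>0. c \<tau> > 0 \<and>
        (\<forall>p\<^sub>0\<in>E. \<forall>R>0.
           (\<integral>\<^sup>+ r \<in> {0<..<R}.
              hausdorff_measure 3 {p \<in> E \<inter> ball p\<^sub>0 R. \<not> symmetric_in_ball \<tau> E p r} / ennreal r
              \<partial>lborel)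
           \<le> ennreal (c \<tau> * R ^ 3)))"

definition vertical_plane :: "heis set \<Rightarrow> bool" where
  "vertical_plane W \<longleftrightarrow>
     (\<exists>V p. subspace V \<and> dim V = 2 \<and> (\<forall>t. (0, 0, t) \<in> V) \<and> W = (\<lambda>v. p * Heis v) ` V)"

definition vertical_beta :: "heis set \<Rightarrow> heis \<Rightarrow> real \<Rightarrow> ennreal" where
  "vertical_beta E p r =
     (INF W \<in> {W. vertical_plane W}. SUP y \<in> ball p r \<inter> E. ennreal (infdist y W / r))"

end

theory Submission
  imports Defs
begin

text \<open>
  If \<open>E\<close> is \<open>\<tau>\<close>-symmetric in \<open>B(p,r)\<close> for a small enough \<open>\<tau>\<close>, then \<open>\<beta>\<^sub>E(p, k r) < \<epsilon>\<close>, where \<open>k\<close>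
  depends only on the regularity constant; the theorem follows by substituting \<open>s = r / k\<close>.
  Rescaling and passing to a limit, it suffices to exclude exactly symmetric \<open>3\<close>-regular sets that
  leave every vertical plane through the origin at scale \<open>k\<close>. Regularity gives a point over some
  \<open>a\<close> with \<open>\<bar>a\<bar>\<close> as small as we like but not zero, and non-flatness a point over some \<open>b\<close> with
  \<open>\<bar>b\<bar> \<le> k\<close> that is transversal to \<open>a\<close>. Compositions of two symmetries act as left translations by
  \<open>(2a, 0)\<close> and \<open>(2b, 0)\<close>, whose commutator is vertical, so the set contains a piece of a discrete
  Heisenberg group. Up to scale one this piece has \<open>1/k\<close> vertical layers, each of them filling a
  plane up to distance \<open>\<delta>\<close>, hence about \<open>\<delta>\<^sup>-\<^sup>3 / k\<close> points that are \<open>\<delta>\<close>-separated, which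
  contradicts the regularity once \<open>k\<close> is small.
\<close>

section \<open>Geometry of the Koranyi metric\<close>

lemma heis_norm_power4: "heis_norm (Heis (x, y, t)) ^ 4 = (x\<^sup>2 + y\<^sup>2)\<^sup>2 + 16 * t\<^sup>2"
  by (simp add: real_root_pow_pos2)

lemma heis_norm_le_iff:
  assumes "0 \<le> s"
  shows "heis_norm (Heis (x, y, t)) \<le> s \<longleftrightarrow> (x\<^sup>2 + y\<^sup>2)\<^sup>2 + 16 * t\<^sup>2 \<le> s ^ 4"
  using assms heis_norm_nonneg[of "Heis (x, y, t)"]
  by (subst heis_norm_power4[symmetric]) (simp del: heis_norm.simps)

lemma heis_norm_horizontal: "heis_norm (Heis (x, y, 0)) = norm (x, y)"
proof -
  have "heis_norm (Heis (x, y, 0)) ^ 4 = norm (x, y) ^ 4"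
    unfolding heis_norm_power4
    by (simp add: norm_Pair power4_eq_xxxx flip: power2_eq_square)
      (simp add: power2_eq_square)
  then show ?thesis
    by (rule power_eq_imp_eq_base) (simp_all del: heis_norm.simps add: heis_norm_nonneg)
qed

lemma norm_heis_proj_le: "norm (heis_proj q) \<le> heis_norm q"
proof (cases q)
  case (Heis x y t)
  have "norm (x, y) ^ 4 \<le> heis_norm (Heis (x, y, t)) ^ 4"
    unfolding heis_norm_power4 heis_norm_horizontal[symmetric] by simp
  then show ?thesis
    using heis_norm_nonneg power_mono_iff[of "norm (x, y)" "heis_norm (Heis (x, y, t))" 4]
    by (simp del: heis_norm.simps add: Heis)
qed

lemma heis_norm_vertical_le: "4 * \<bar>t\<bar> \<le> (heis_norm (Heis (x, y, t)))\<^sup>2"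
proof -
  have "(4 * \<bar>t\<bar>)\<^sup>2 \<le> ((heis_norm (Heis (x, y, t)))\<^sup>2)\<^sup>2"
    using heis_norm_power4[of x y t] by (simp del: heis_norm.simps add: power_mult_distrib)
  then show ?thesis
    by (rule power2_le_imp_le) simp
qed

text \<open>Split off a vertical factor: \<open>Heis (x, y, 0) * Heis (0, 0, t)\<close> has no cross
  term, and the second factor has norm at most \<open>2 * sqrt \<bar>t\<bar>\<close>.\<close>

lemma heis_norm_le: "heis_norm (Heis (x, y, t)) \<le> norm (x, y) + 2 * sqrt \<bar>t\<bar>"
proof -
  have "heis_norm (Heis (0, 0, t)) \<le> 2 * sqrt \<bar>t\<bar>"
    by (subst heis_norm_le_iff) (simp_all add: power4_eq_xxxx power2_eq_square)
  then show ?thesis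
    using heis_norm_triangle[of "Heis (x, y, 0)" "Heis (0, 0, t)"]
    by (simp del: heis_norm.simps add: heis_norm_horizontal)
qed

lemma dist_heis_one: "dist q 1 = heis_norm q" for q :: heis
  by (cases q) (simp add: dist_heis_def one_heis_def)

lemma dist_heis_mult_left: "dist (p * q) (p * q') = dist q q'" for p q q' :: heis
  unfolding dist_heis_def heis_inverse_mult
  by (metis heis_left_inverse mult.assoc mult_1_left)

lemma dist_Heis:
  "dist (Heis (x, y, t)) (Heis (x', y', t')) =
     heis_norm (Heis (x - x', y - y', t - t' - 1/2 * (x' * y - y' * x)))"
proof -
  have "inverse (Heis (x', y', t')) * Heis (x, y, t) =
      Heis (x - x', y - y', t - t' - 1/2 * (x' * y - y' * x))"
    by (simp add: field_simps)
  then show ?thesis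
    by (simp only: dist_heis_def)
qed

lemma norm_heis_proj_diff_le: "norm (heis_proj p - heis_proj q) \<le> dist p q"
proof (cases p; cases q)
  fix x y t x' y' t' assume "p = Heis (x, y, t)" and "q = Heis (x', y', t')"
  then show ?thesis
    using norm_heis_proj_le[of "inverse q * p"] by (simp add: dist_heis_def)
qed

section \<open>Dilations\<close>

fun heis_dil :: "real \<Rightarrow> heis \<Rightarrow> heis" where
  "heis_dil r (Heis (x, y, t)) = Heis (r * x, r * y, r\<^sup>2 * t)"

lemma heis_norm_dil:
  assumes "0 \<le> r"
  shows "heis_norm (heis_dil r q) = r * heis_norm q"
proof (cases q)
  case (Heis x y t)
  have "heis_norm (heis_dil r q) ^ 4 = (r * heis_norm q) ^ 4"
    unfolding Heis heis_dil.simps power_mult_distrib heis_norm_power4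
    by (simp add: power_mult_distrib power4_eq_xxxx power2_eq_square algebra_simps)
  then show ?thesis
    by (rule power_eq_imp_eq_base)
      (simp_all del: heis_norm.simps add: heis_norm_nonneg assms)
qed

lemma heis_dil_mult: "heis_dil r (p * q) = heis_dil r p * heis_dil r q"
  by (cases p; cases q) (simp add: power2_eq_square algebra_simps)

lemma heis_dil_inverse: "heis_dil r (inverse p) = inverse (heis_dil r p)"
  by (cases p) simp

lemma dist_heis_dil: "0 \<le> r \<Longrightarrow> dist (heis_dil r p) (heis_dil r q) = r * dist p q"
  unfolding dist_heis_def heis_dil_mult[symmetric] heis_dil_inverse[symmetric]
  by (rule heis_norm_dil)

section \<open>Symmetric points and their equivariance\<close>

lemma symmetric_point_Heis:
  "symmetric_point (Heis (x, y, t)) (Heis (u, v, s)) =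
     Heis (2 * x - u, 2 * y - v, s + (u * y - v * x))"
  by (simp add: symmetric_point_def Let_def field_simps)

lemma symmetric_point_mult_left:
  "symmetric_point (g * p) (g * q) = g * symmetric_point p q"
  by (cases g; cases p; cases q) (simp add: symmetric_point_Heis field_simps)

lemma symmetric_point_dil:
  "symmetric_point (heis_dil r p) (heis_dil r q) = heis_dil r (symmetric_point p q)"
  by (cases p; cases q) (simp add: symmetric_point_Heis power2_eq_square algebra_simps)

text \<open>The symmetric point is the product of the horizontal element over twice the projection
  of \<open>p\<close> and the image of \<open>q\<close> under the norm-preserving map that changes
  the sign of the projection.\<close>

lemma heis_norm_symmetric_point_le:
  "heis_norm (symmetric_point p q) \<le> 2 * heis_norm p + heis_norm q"
proof (cases p; cases q)
  fix x y t u v s assume p: "p = Heis (x, y, t)" and q: "q = Heis (u, v, s)"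
  have "symmetric_point p q = Heis (2 * x, 2 * y, 0) * Heis (- u, - v, s)"
    by (simp add: p q symmetric_point_Heis algebra_simps)
  then have "heis_norm (symmetric_point p q) \<le>
      heis_norm (Heis (2 * x, 2 * y, 0)) + heis_norm (Heis (- u, - v, s))"
    by (simp only: heis_norm_triangle)
  also have "heis_norm (Heis (- u, - v, s)) = heis_norm q"
    by (simp add: q)
  also have "heis_norm (Heis (2 * x, 2 * y, 0)) = 2 * norm (heis_proj p)"
    unfolding heis_norm_horizontal using norm_scaleR[of 2 "(x, y)"] by (simp add: p)
  finally show ?thesis
    using norm_heis_proj_le[of p] by simp
qed

section \<open>Convergence in the Koranyi metric and in coordinates\<close>

lemma tendsto_Heis:
  assumes "(v \<longlongrightarrow> w) F"
  shows "((\<lambda>n. Heis (v n)) \<longlongrightarrow> Heis w) F"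
proof -
  obtain a b c where w: "w = (a, b, c)"
    by (cases w)
  define x y t where "x n = fst (v n)" "y n = fst (snd (v n))" "t n = snd (snd (v n))" for n
  have v: "v n = (x n, y n, t n)" for n
    by (simp add: x_y_t_def)
  have lim: "(x \<longlongrightarrow> a) F" "(y \<longlongrightarrow> b) F" "(t \<longlongrightarrow> c) F"
    using tendsto_fst[OF assms] tendsto_fst[OF tendsto_snd[OF assms]]
      tendsto_snd[OF tendsto_snd[OF assms]]
    unfolding x_y_t_def w by simp_all
  have "((\<lambda>n. root 4 (((x n - a)\<^sup>2 + (y n - b)\<^sup>2)\<^sup>2
        + 16 * (t n - c - 1/2 * (a * y n - b * x n))\<^sup>2)) \<longlongrightarrow>
      root 4 (((a - a)\<^sup>2 + (b - b)\<^sup>2)\<^sup>2 + 16 * (c - c - 1/2 * (a * b - b * a))\<^sup>2)) F"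
    by (intro tendsto_intros lim)
  then have "((\<lambda>n. dist (Heis (v n)) (Heis w)) \<longlongrightarrow> 0) F"
    by (simp add: v w dist_Heis)
  then show ?thesis
    by (rule tendsto_dist_iff[THEN iffD2])
qed

text \<open>The projection is 1-Lipschitz. In the vertical direction the distance controls only
  \<open>s n\<close>, the height after the left translation taking \<open>l\<close> to the origin;
  it differs from \<open>t n - c\<close> by a cross term that tends to zero.\<close>

lemma tendsto_coords:
  assumes "(X \<longlongrightarrow> l) F"
  shows "((\<lambda>n. coords (X n)) \<longlongrightarrow> coords l) F"
proof -
  obtain a b c where l: "l = Heis (a, b, c)"
    by (cases l)
  define x y t where
    "x n = fst (coords (X n))" "y n = fst (snd (coords (X n)))" "t n = snd (snd (coords (X n)))"
    for n
  have X: "X n = Heis (x n, y n, t n)" for n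
    by (simp add: x_y_t_def)
  have d0: "((\<lambda>n. dist (X n) l) \<longlongrightarrow> 0) F"
    using assms by (rule tendsto_dist_iff[THEN iffD1])
  have "norm ((x n, y n) - (a, b)) \<le> dist (X n) l" for n
    using norm_heis_proj_diff_le[of "X n" l] unfolding X l by simp
  then have "((\<lambda>n. (x n, y n) - (a, b)) \<longlongrightarrow> 0) F"
    by (intro Lim_null_comparison[OF _ d0]) auto
  then have lim: "((\<lambda>n. (x n, y n)) \<longlongrightarrow> (a, b)) F"
    by (rule LIM_zero_cancel)
  note x = tendsto_fst[OF lim, simplified] and y = tendsto_snd[OF lim, simplified]
  define s where "s n = t n - c - 1/2 * (a * y n - b * x n)" for n
  have "norm (s n) \<le> (dist (X n) l)\<^sup>2 / 4" for n
    using heis_norm_vertical_le[of "s n" "x n - a" "y n - b"]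
    unfolding X l dist_Heis s_def by simp
  moreover have "((\<lambda>n. (dist (X n) l)\<^sup>2 / 4) \<longlongrightarrow> 0) F"
    using tendsto_divide[OF tendsto_power[OF d0, of 2] tendsto_const[of 4]] by simp
  ultimately have "(s \<longlongrightarrow> 0) F"
    by (rule Lim_null_comparison[OF always_eventually, rule_format])
  then have "((\<lambda>n. s n + c + 1/2 * (a * y n - b * x n)) \<longlongrightarrow> 0 + c + 1/2 * (a * b - b * a)) F"
    by (intro tendsto_intros x y)
  then have "(t \<longlongrightarrow> c) F"
    by (simp add: s_def)
  with x y have "((\<lambda>n. (x n, y n, t n)) \<longlongrightarrow> (a, b, c)) F"
    by (intro tendsto_Pair)
  then show ?thesis
    by (simp add: X l)
qed

lemma tendsto_symmetric_point:
  assumes "(X \<longlongrightarrow> p) F" and "(Y \<longlongrightarrow> q) F"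
  shows "((\<lambda>n. symmetric_point (X n) (Y n)) \<longlongrightarrow> symmetric_point p q) F"
proof -
  define f where "f u v = (2 * fst u - fst v, 2 * fst (snd u) - fst (snd v),
      snd (snd v) + (fst v * fst (snd u) - fst (snd v) * fst u))"
    for u v :: "real \<times> real \<times> real"
  have f: "symmetric_point a b = Heis (f (coords a) (coords b))" for a b
    by (cases a; cases b) (simp add: symmetric_point_Heis f_def)
  show ?thesis
    unfolding f unfolding f_def
    by (intro tendsto_Heis tendsto_intros tendsto_coords assms)
qed

text \<open>A bound on the norm bounds the coordinates, so Bolzano-Weierstrass in R^3 applies, and
  \<open>tendsto_Heis\<close> carries the convergence back.\<close>

lemma heis_bounded_subseq:
  assumes "\<And>n::nat. heis_norm (X n) \<le> M"
  obtains l \<sigma> where "strict_mono \<sigma>" and "(X \<circ> \<sigma>) \<longlonglongrightarrow> l"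
proof -
  have "norm (coords q) \<le> M + M\<^sup>2" if "heis_norm q \<le> M" for q
  proof (cases q)
    case (Heis x y t)
    have M: "0 \<le> M"
      using that heis_norm_nonneg[of q] by linarith
    have sq: "(heis_norm q)\<^sup>2 \<le> M\<^sup>2"
      using that heis_norm_nonneg by (intro power_mono) auto
    have "norm (coords q) = norm ((x, y, 0) + (0, 0, t))"
      by (simp add: Heis)
    also have "\<dots> \<le> norm (x, y) + \<bar>t\<bar>"
      by (rule order_trans[OF norm_triangle_ineq]) (simp add: norm_Pair)
    also have "\<dots> \<le> M + M\<^sup>2"
      using norm_heis_proj_le[of q] heis_norm_vertical_le[of t x y] that sq
      by (auto simp: Heis simp del: heis_norm.simps)
    finally show ?thesis .
  qed
  then have "bounded (range (\<lambda>n. coords (X n)))"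
    using assms unfolding bounded_iff by blast
  then obtain v \<sigma> where \<sigma>: "strict_mono \<sigma>" and "((\<lambda>n. coords (X n)) \<circ> \<sigma>) \<longlonglongrightarrow> v"
    using bounded_imp_convergent_subsequence by blast
  then have "(\<lambda>n. Heis (coords (X (\<sigma> n)))) \<longlonglongrightarrow> Heis v"
    by (intro tendsto_Heis) (simp add: comp_def)
  then show ?thesis
    using \<sigma> that by (simp add: comp_def)
qed

section \<open>Hausdorff measure and regularity\<close>

lemma hausdorff_content_mono:
  "X \<subseteq> Y \<Longrightarrow> hausdorff_content s \<delta> X \<le> hausdorff_content s \<delta> Y"
  unfolding hausdorff_content_def by (rule INF_superset_mono) auto

lemma hausdorff_content_antimono:
  "\<delta> \<le> \<delta>' \<Longrightarrow> hausdorff_content s \<delta>' X \<le> hausdorff_content s \<delta> X"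
  unfolding hausdorff_content_def by (rule INF_superset_mono) (auto intro: order_trans)

lemma hausdorff_measure_mono:
  "X \<subseteq> Y \<Longrightarrow> hausdorff_measure s X \<le> hausdorff_measure s Y"
  unfolding hausdorff_measure_def by (intro SUP_mono') (rule hausdorff_content_mono)

lemma hausdorff_measure_empty: "hausdorff_measure s {} = 0"
proof -
  have "hausdorff_content s \<delta> {} \<le> 0" if "\<delta> > 0" for \<delta>
    unfolding hausdorff_content_def using that
    by (intro INF_lower2[of "\<lambda>_. {}"]) (auto simp: diameter_def)
  then have "hausdorff_measure s {} \<le> 0"
    unfolding hausdorff_measure_def by (intro SUP_least) auto
  then show ?thesis
    by simp
qed

text \<open>Near-optimal covers of the two sets are interleaved, one at the even and one at the odd
  indices, into a single sequence.\<close>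

lemma hausdorff_content_Un_le:
  "hausdorff_content s \<delta> (X \<union> Y) \<le> hausdorff_content s \<delta> X + hausdorff_content s \<delta> Y"
proof -
  define cov where "cov Z = {U :: nat \<Rightarrow> 'a set. Z \<subseteq> (\<Union>i. U i) \<and>
    (\<forall>i. bounded (U i) \<and> diameter (U i) \<le> \<delta>)}" for Z
  define m where "m U = (\<Sum>i. ennreal (diameter (U i) powr s))" for U :: "nat \<Rightarrow> 'a set"
  have content: "hausdorff_content s \<delta> Z = (INF U\<in>cov Z. m U)" for Z
    by (simp add: hausdorff_content_def cov_def m_def)
  have *: "hausdorff_content s \<delta> (X \<union> Y) \<le> m U + m V" if U: "U \<in> cov X" and V: "V \<in> cov Y" for U V
  proof -
    define W where "W i = (if even i then U (i div 2) else V (i div 2))" for i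
    have UW: "U i = W (2 * i)" and VW: "V i = W (2 * i + 1)" for i
      by (simp_all add: W_def)
    have "X \<union> Y \<subseteq> (\<Union>i. U i) \<union> (\<Union>i. V i)"
      using U V unfolding cov_def by (intro Un_mono) simp_all
    also have "\<dots> \<subseteq> (\<Union>i. W i)"
      unfolding UW VW by (intro Un_least UN_least UN_upper UNIV_I)
    finally have "X \<union> Y \<subseteq> (\<Union>i. W i)" .
    moreover have "bounded (W i) \<and> diameter (W i) \<le> \<delta>" for i
      using U V by (simp add: cov_def W_def)
    ultimately have "W \<in> cov (X \<union> Y)"
      by (simp add: cov_def)
    moreover have "m W \<le> m U + m V"
    proof -
      define w where "w i = ennreal (diameter (W i) powr s)" for i
      have split: "sum w {..<2 * n} = (\<Sum>i<n. w (2 * i)) + (\<Sum>i<n. w (2 * i + 1))" for n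
        by (induction n) (simp_all add: algebra_simps)
      have "m W = (SUP n. sum w {..<n})"
        unfolding m_def w_def by (rule suminf_eq_SUP)
      also have "\<dots> \<le> m U + m V"
      proof (rule SUP_least)
        fix n
        have "sum w {..<n} \<le> sum w {..<2 * n}"
          by (intro sum_mono2) auto
        also have "\<dots> \<le> m U + m V"
          unfolding split m_def UW VW w_def[symmetric]
          by (intro add_mono sum_le_suminf) auto
        finally show "sum w {..<n} \<le> m U + m V" .
      qed
      finally show ?thesis .
    qed
    moreover have "hausdorff_content s \<delta> (X \<union> Y) \<le> m W" if "W \<in> cov (X \<union> Y)"
      unfolding content using that by (rule INF_lower)
    ultimately show ?thesis
      by (auto intro: order_trans)
  qed
  show ?thesis
  \<comment> \<open>The right-hand side may be taken finite, so both contents are finite and covers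
    within \<open>e / 2\<close> of each infimum exist.\<close>
  proof (rule ennreal_le_epsilon)
    fix e :: real
    assume fin: "hausdorff_content s \<delta> X + hausdorff_content s \<delta> Y < top" and "0 < e"
    then have e: "0 < ennreal (e / 2)"
      by simp
    have less: "hausdorff_content s \<delta> Z < hausdorff_content s \<delta> Z + ennreal (e / 2)"
      if "hausdorff_content s \<delta> Z < top" for Z :: "'a set"
      using that e ennreal_add_left_cancel_less[of "hausdorff_content s \<delta> Z" 0] by simp
    have fin': "hausdorff_content s \<delta> X < top" "hausdorff_content s \<delta> Y < top"
      using fin by simp_all
    obtain U where U: "U \<in> cov X" "m U < hausdorff_content s \<delta> X + ennreal (e / 2)"
      using less[OF fin'(1)] unfolding content[of X] INF_less_iff by blast
    obtain V where V: "V \<in> cov Y" "m V < hausdorff_content s \<delta> Y + ennreal (e / 2)"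
      using less[OF fin'(2)] unfolding content[of Y] INF_less_iff by blast
    have "hausdorff_content s \<delta> (X \<union> Y) \<le>
        (hausdorff_content s \<delta> X + ennreal (e / 2)) + (hausdorff_content s \<delta> Y + ennreal (e / 2))"
      using U(2) V(2) by (intro order_trans[OF *[OF U(1) V(1)]] add_mono less_imp_le)
    also have "\<dots> = hausdorff_content s \<delta> X + hausdorff_content s \<delta> Y + (ennreal (e / 2) + ennreal (e / 2))"
      by (simp only: ac_simps)
    also have "ennreal (e / 2) + ennreal (e / 2) = ennreal e"
      using \<open>0 < e\<close> by (subst ennreal_plus[symmetric]) auto
    finally show "hausdorff_content s \<delta> (X \<union> Y) \<le>
        hausdorff_content s \<delta> X + hausdorff_content s \<delta> Y + ennreal e" .
  qed
qed

lemma hausdorff_measure_Un_le: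
  "hausdorff_measure s (X \<union> Y) \<le> hausdorff_measure s X + hausdorff_measure s Y"
  unfolding hausdorff_measure_def
proof (rule SUP_least)
  fix \<delta> :: real assume "\<delta> \<in> {0<..}"
  then show "hausdorff_content s \<delta> (X \<union> Y) \<le>
      (SUP \<delta>\<in>{0<..}. hausdorff_content s \<delta> X) + (SUP \<delta>\<in>{0<..}. hausdorff_content s \<delta> Y)"
    by (intro order_trans[OF hausdorff_content_Un_le] add_mono SUP_upper)
qed

lemma hausdorff_measure_UN_le:
  assumes "finite I"
  shows "hausdorff_measure s (\<Union>i\<in>I. X i) \<le> (\<Sum>i\<in>I. hausdorff_measure s (X i))"
  using assms
proof (induction I rule: finite_induct)
  case (insert i I)
  then show ?case
    using order_trans[OF hausdorff_measure_Un_le add_left_mono] by (auto simp: hausdorff_measure_empty)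
qed (simp add: hausdorff_measure_empty)

text \<open>A covering set of diameter less than \<open>\<eta>\<close> meets at most one of the two sets.\<close>

lemma hausdorff_content_separated:
  assumes sep: "\<And>x y. x \<in> X \<Longrightarrow> y \<in> Y \<Longrightarrow> \<eta> \<le> dist x y" and "0 < \<delta>" and "\<delta> < \<eta>"
  shows "hausdorff_content s \<delta> X + hausdorff_content s \<delta> Y \<le> hausdorff_content s \<delta> (X \<union> Y)"
  unfolding hausdorff_content_def[of s \<delta> "X \<union> Y"]
proof (rule INF_greatest)
  fix U :: "nat \<Rightarrow> 'a set"
  assume "U \<in> {U. X \<union> Y \<subseteq> (\<Union>i. U i) \<and> (\<forall>i. bounded (U i) \<and> diameter (U i) \<le> \<delta>)}"
  then have cov: "X \<union> Y \<subseteq> (\<Union>i. U i)" and bd: "\<And>i. bounded (U i)" and diam: "\<And>i. diameter (U i) \<le> \<delta>"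
    by auto
  define V where "V Z i = (if U i \<inter> Z = {} then {} else U i)" for Z i
  have le: "hausdorff_content s \<delta> Z \<le> (\<Sum>i. ennreal (diameter (V Z i) powr s))"
    if "Z \<subseteq> X \<union> Y" for Z
    unfolding hausdorff_content_def
  proof (rule INF_lower, safe)
    fix x assume "x \<in> Z"
    then obtain i where "x \<in> U i"
      using cov \<open>Z \<subseteq> X \<union> Y\<close> by blast
    with \<open>x \<in> Z\<close> show "x \<in> (\<Union>i. V Z i)"
      by (auto simp: V_def)
  qed (use bd diam \<open>0 < \<delta>\<close> in \<open>auto simp: V_def\<close>)
  have disj: "V X i = {} \<or> V Y i = {}" for i
  proof (rule ccontr)
    assume "\<not> ?thesis"
    then obtain x y where "x \<in> X" "y \<in> Y" "x \<in> U i" "y \<in> U i"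
      by (auto simp: V_def split: if_splits)
    then show False
      using sep[of x y] diameter_bounded_bound[OF bd, of x i y] diam[of i] \<open>\<delta> < \<eta>\<close> by auto
  qed
  have "ennreal (diameter (V X i) powr s) + ennreal (diameter (V Y i) powr s)
      \<le> ennreal (diameter (U i) powr s)" for i
    using disj[of i] by (auto simp: V_def diameter_def split: if_splits)
  then have "(\<Sum>i. ennreal (diameter (V X i) powr s)) + (\<Sum>i. ennreal (diameter (V Y i) powr s))
      \<le> (\<Sum>i. ennreal (diameter (U i) powr s))"
    by (subst suminf_add) (auto intro!: suminf_le)
  then show "hausdorff_content s \<delta> X + hausdorff_content s \<delta> Y \<le> (\<Sum>i. ennreal (diameter (U i) powr s))"
    by (rule order_trans[OF add_mono[OF le le], rotated 2]) auto
qed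

text \<open>Contents at two unrelated scales are dominated by those at one common scale below both
  and below \<open>\<eta>\<close>, where no covering set meets both \<open>X\<close> and
  \<open>Y\<close>; then the suprema are taken one after the other.\<close>

lemma hausdorff_measure_separated:
  assumes sep: "\<And>x y. x \<in> X \<Longrightarrow> y \<in> Y \<Longrightarrow> \<eta> \<le> dist x y" and "0 < \<eta>"
  shows "hausdorff_measure s X + hausdorff_measure s Y \<le> hausdorff_measure s (X \<union> Y)"
proof -
  have "hausdorff_content s d X + hausdorff_content s d' Y \<le> hausdorff_measure s (X \<union> Y)"
    if "0 < d" and "0 < d'" for d d'
  proof -
    define \<delta> where "\<delta> = min (\<eta> / 2) (min d d')"
    have \<delta>: "0 < \<delta>" "\<delta> < \<eta>" "\<delta> \<le> d" "\<delta> \<le> d'"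
      using that \<open>0 < \<eta>\<close> by (auto simp: \<delta>_def)
    have "hausdorff_content s d X + hausdorff_content s d' Y \<le>
        hausdorff_content s \<delta> X + hausdorff_content s \<delta> Y"
      using \<delta> by (intro add_mono hausdorff_content_antimono)
    also have "\<dots> \<le> hausdorff_content s \<delta> (X \<union> Y)"
      using hausdorff_content_separated[OF sep] \<delta> by blast
    also have "\<dots> \<le> hausdorff_measure s (X \<union> Y)"
      unfolding hausdorff_measure_def using \<delta> by (intro SUP_upper) auto
    finally show ?thesis .
  qed
  then have "(SUP d'\<in>{0<..}. SUP d\<in>{0<..}. hausdorff_content s d X + hausdorff_content s d' Y) \<le>
      hausdorff_measure s (X \<union> Y)"
    by (intro SUP_least) auto
  moreover have "hausdorff_measure s X + hausdorff_measure s Y =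
      (SUP d'\<in>{0<..}. hausdorff_measure s X + hausdorff_content s d' Y)"
    unfolding hausdorff_measure_def[of s Y] by (rule ennreal_SUP_add_right) auto
  moreover have "hausdorff_measure s X + hausdorff_content s d' Y =
      (SUP d\<in>{0<..}. hausdorff_content s d X + hausdorff_content s d' Y)" for d'
    unfolding hausdorff_measure_def by (rule ennreal_SUP_add_left[symmetric]) auto
  ultimately show ?thesis
    by simp
qed

lemma hausdorff_measure_separated_UN:
  assumes "finite I" and "0 < \<eta>"
    and "\<And>i j x y. i \<in> I \<Longrightarrow> j \<in> I \<Longrightarrow> i \<noteq> j \<Longrightarrow> x \<in> X i \<Longrightarrow> y \<in> X j \<Longrightarrow> \<eta> \<le> dist x y"
  shows "(\<Sum>i\<in>I. hausdorff_measure s (X i)) \<le> hausdorff_measure s (\<Union>i\<in>I. X i)"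
  using assms(1,3)
proof (induction I rule: finite_induct)
  case (insert i I)
  have "(\<Sum>i\<in>insert i I. hausdorff_measure s (X i)) \<le>
      hausdorff_measure s (X i) + hausdorff_measure s (\<Union>i\<in>I. X i)"
    using insert by (auto intro!: add_left_mono insert.IH)
  also have "\<dots> \<le> hausdorff_measure s (X i \<union> (\<Union>i\<in>I. X i))"
  proof (rule hausdorff_measure_separated[OF _ \<open>0 < \<eta>\<close>])
    fix x y assume "x \<in> X i" "y \<in> (\<Union>i\<in>I. X i)"
    then obtain j where "j \<in> I" "y \<in> X j"
      by blast
    with \<open>x \<in> X i\<close> insert.hyps show "\<eta> \<le> dist x y"
      by (intro insert.prems[of i j]) auto
  qed
  finally show ?case
    by simp
qed simp

section \<open>Consequences of 3-regularity\<close>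

lemma three_regularD:
  assumes "three_regular A E" "p \<in> E" "r > 0" "bounded E \<Longrightarrow> r \<le> diameter E"
  shows "ennreal (r ^ 3 / A) \<le> hausdorff_measure 3 (E \<inter> ball p r)"
    and "hausdorff_measure 3 (E \<inter> ball p r) \<le> ennreal (A * r ^ 3)"
  using assms unfolding three_regular_def by auto

text \<open>Packing: balls of radius \<open>\<delta> / 4\<close> around the points of
  \<open>S\<close> are \<open>\<delta> / 2\<close> apart and lie in \<open>ball p (2 * R)\<close>.
  Lower regularity of the small balls against upper regularity of the large one gives the factor 512
  = 4^3 * 2^3.\<close>

lemma three_regular_card_separated:
  fixes A R \<delta> :: real
  assumes reg: "three_regular A E" and p: "p \<in> E"
    and diam: "bounded E \<Longrightarrow> 2 * R \<le> diameter E"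
    and S: "finite S" "S \<subseteq> E \<inter> ball p R"
    and sep: "\<And>x y. x \<in> S \<Longrightarrow> y \<in> S \<Longrightarrow> x \<noteq> y \<Longrightarrow> \<delta> \<le> dist x y"
    and \<delta>: "0 < \<delta>" "\<delta> \<le> R"
  shows "card S * \<delta> ^ 3 \<le> 512 * A\<^sup>2 * R ^ 3"
proof -
  have A: "A \<ge> 1"
    using reg by (simp add: three_regular_def)
  have "ennreal (card S * ((\<delta> / 4) ^ 3 / A)) = (\<Sum>x\<in>S. ennreal ((\<delta> / 4) ^ 3 / A))"
    using A \<delta> by (subst sum_ennreal) auto
  also have "\<dots> \<le> (\<Sum>x\<in>S. hausdorff_measure 3 (E \<inter> ball x (\<delta> / 4)))"
    using S \<delta> diam by (intro sum_mono three_regularD(1)[OF reg]) force+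
  also have "\<dots> \<le> hausdorff_measure 3 (\<Union>x\<in>S. E \<inter> ball x (\<delta> / 4))"
  proof (rule hausdorff_measure_separated_UN[of _ "\<delta> / 2"])
    fix x y u v assume "x \<in> S" "y \<in> S" "x \<noteq> y" "u \<in> E \<inter> ball x (\<delta> / 4)" "v \<in> E \<inter> ball y (\<delta> / 4)"
    then have "\<delta> \<le> dist x y" "dist x u < \<delta> / 4" "dist y v < \<delta> / 4"
      using sep by auto
    then show "\<delta> / 2 \<le> dist u v"
      using dist_triangle[of x y u] dist_triangle[of u y v] by (simp add: dist_commute)
  qed (use S \<delta> in auto)
  also have "\<dots> \<le> hausdorff_measure 3 (E \<inter> ball p (2 * R))"
  proof (rule hausdorff_measure_mono, safe)
    fix x y assume "x \<in> S" "y \<in> ball x (\<delta> / 4)"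
    then have "dist p x < R" "dist x y < R"
      using S \<delta> by auto
    then show "y \<in> ball p (2 * R)"
      using dist_triangle[of p y x] by simp
  qed
  also have "\<dots> \<le> ennreal (A * (2 * R) ^ 3)"
    using \<delta> diam by (intro three_regularD(2)[OF reg p]) auto
  finally have "card S * ((\<delta> / 4) ^ 3 / A) \<le> A * (2 * R) ^ 3"
    using A \<delta> by (subst (asm) ennreal_le_iff) auto
  then show ?thesis
    using A by (simp add: field_simps power2_eq_square)
qed


lemma abs_cross_le: "\<bar>x * v - y * u\<bar> \<le> norm (x, y) * norm (u, v)" for x y u v :: real
proof -
  have "\<bar>(x, y) \<bullet> (v, - u)\<bar> \<le> norm (x, y) * norm (v, - u)"
    by (rule Cauchy_Schwarz_ineq2)
  then show ?thesis
    by (simp add: norm_Pair add.commute)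
qed

text \<open>
  A vertical line has Hausdorff dimension 2, so a thin tube around it is covered by too few balls
  of its own thickness to carry the measure that regularity forces.
\<close>

lemma three_regular_not_vertical:
  assumes reg: "three_regular A E" and p: "p \<in> E" and "0 < \<rho>"
    and diam: "bounded E \<Longrightarrow> \<rho> \<le> diameter E"
  shows "\<exists>q\<in>E \<inter> ball p \<rho>. \<rho> / (200 * A\<^sup>2) \<le> norm (heis_proj q - heis_proj p)"
proof (rule ccontr)
  assume contra: "\<not> ?thesis"
  have A: "A \<ge> 1"
    using reg by (simp add: three_regular_def)
  then have A2: "1 \<le> A\<^sup>2"
    by (simp add: one_le_power)
  \<comment> \<open>The relative radius of the tube; it makes the final factor
    \<open>125 * (A\<^sup>2 * \<kappa>)\<close> smaller than one.\<close>
  define \<kappa> where "\<kappa> = 1 / (200 * A\<^sup>2)"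
  have \<kappa>: "0 < \<kappa>" "\<kappa> \<le> 1 / 200" "A\<^sup>2 * \<kappa> = 1 / 200"
    using A2 by (auto simp: \<kappa>_def divide_simps)
  define s where "s = \<kappa> * \<rho>"
  have s: "0 < s" "5 * s \<le> \<rho>"
    using \<kappa> \<open>0 < \<rho>\<close> mult_right_mono[of \<kappa> "1 / 200" \<rho>] by (auto simp: s_def)
  have thin: "norm (heis_proj q - heis_proj p) < s" if "q \<in> E \<inter> ball p \<rho>" for q
    using contra that by (force simp: s_def \<kappa>_def)
  \<comment> \<open>The height relative to \<open>p\<close>. The tube of radius \<open>s\<close> is
    cut into slabs of height \<open>s\<^sup>2\<close>, which is how a ball of radius
    \<open>s\<close> scales vertically.\<close>
  define h where "h q = snd (snd (coords (inverse p * q)))" for q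
  define cell where "cell j = {q \<in> E \<inter> ball p \<rho>. \<lfloor>h q / s\<^sup>2\<rfloor> = j}" for j :: int
  define J where "J = \<lfloor>1 / (4 * \<kappa>\<^sup>2)\<rfloor>"
  have h_le: "\<bar>h q / s\<^sup>2\<bar> \<le> 1 / (4 * \<kappa>\<^sup>2)" if "q \<in> ball p \<rho>" for q
  proof -
    obtain x y t where xyt: "inverse p * q = Heis (x, y, t)"
      by (cases "inverse p * q")
    have "heis_norm (Heis (x, y, t)) \<le> \<rho>"
      using that unfolding xyt[symmetric] dist_heis_def[symmetric] by (simp add: dist_commute)
    then have "(heis_norm (Heis (x, y, t)))\<^sup>2 \<le> \<rho>\<^sup>2"
      by (intro power_mono heis_norm_nonneg)
    then have "4 * \<bar>h q\<bar> \<le> \<rho>\<^sup>2"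
      using heis_norm_vertical_le[of t x y] by (simp add: h_def xyt)
    then show ?thesis
      using \<kappa> \<open>0 < \<rho>\<close> by (simp add: s_def field_simps power_mult_distrib)
  qed
  have cover: "E \<inter> ball p \<rho> \<subseteq> (\<Union>j\<in>{- J - 1..J}. cell j)"
  proof
    fix q assume q: "q \<in> E \<inter> ball p \<rho>"
    have "h q / s\<^sup>2 \<le> 1 / (4 * \<kappa>\<^sup>2)" "- (1 / (4 * \<kappa>\<^sup>2)) \<le> h q / s\<^sup>2"
      using h_le[of q] q unfolding abs_le_iff by (simp_all add: minus_le_iff)
    then have "\<lfloor>h q / s\<^sup>2\<rfloor> \<in> {- J - 1..J}"
      unfolding J_def by (simp add: floor_mono) linarith
    with q show "q \<in> (\<Union>j\<in>{- J - 1..J}. cell j)"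
      by (auto simp: cell_def)
  qed
  \<comment> \<open>The horizontal part contributes less than \<open>2 * s\<close>. Slab height and
    cross term add up to at most \<open>3/2 * s\<^sup>2\<close>, so the vertical part contributes at
    most \<open>3 * s\<close>.\<close>
  have close: "dist q q' < 5 * s" if q: "q \<in> cell j" and q': "q' \<in> cell j" for q q' j
  proof -
    obtain x y t where xyt: "inverse p * q = Heis (x, y, t)"
      by (cases "inverse p * q")
    obtain u v w where uvw: "inverse p * q' = Heis (u, v, w)"
      by (cases "inverse p * q'")
    have z: "norm (x, y) < s"
      using thin[of q] q xyt by (cases p; cases q) (auto simp: cell_def)
    have z': "norm (u, v) < s"
      using thin[of q'] q' uvw by (cases p; cases q') (auto simp: cell_def)
    have "\<bar>t / s\<^sup>2 - w / s\<^sup>2\<bar> \<le> 1"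
      using q q' by (simp add: cell_def h_def xyt uvw) linarith
    then have tw: "\<bar>t - w\<bar> \<le> s\<^sup>2"
      using s by (simp add: diff_divide_distrib[symmetric] field_simps)
    have "\<bar>u * y - v * x\<bar> \<le> norm (u, v) * norm (x, y)"
      by (rule abs_cross_le)
    also have "\<dots> \<le> s * s"
      using z z' s by (intro mult_mono) auto
    finally have "\<bar>t - w - 1/2 * (u * y - v * x)\<bar> \<le> (3/2 * s)\<^sup>2"
      using tw zero_le_square[of s] unfolding power2_eq_square by argo
    then have "sqrt \<bar>t - w - 1/2 * (u * y - v * x)\<bar> \<le> 3/2 * s"
      using s by (intro real_le_lsqrt) auto
    moreover have "norm (x - u, y - v) < 2 * s"
      using norm_triangle_ineq4[of "(x, y)" "(u, v)"] z z' by simp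
    moreover have "dist q q' = heis_norm (Heis (x - u, y - v, t - w - 1/2 * (u * y - v * x)))"
      unfolding dist_Heis[symmetric] xyt[symmetric] uvw[symmetric] dist_heis_mult_left ..
    ultimately show ?thesis
      using heis_norm_le[of "x - u" "y - v" "t - w - 1/2 * (u * y - v * x)"] by linarith
  qed
  have cell_le: "hausdorff_measure 3 (cell j) \<le> ennreal (A * (5 * s) ^ 3)" for j
  proof (cases "cell j = {}")
    case False
    then obtain e where e: "e \<in> cell j"
      by blast
    have "hausdorff_measure 3 (cell j) \<le> hausdorff_measure 3 (E \<inter> ball e (5 * s))"
      using close[OF e] by (intro hausdorff_measure_mono) (auto simp: cell_def)
    also have "\<dots> \<le> ennreal (A * (5 * s) ^ 3)"
      using e s diam by (intro three_regularD(2)[OF reg]) (auto simp: cell_def)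
    finally show ?thesis .
  qed (simp add: hausdorff_measure_empty)
  have "0 \<le> J"
    by (simp add: J_def)
  \<comment> \<open>There are \<open>2 * J + 2\<close> slabs, the extra one because floors of
    negative numbers round down; the summand 2 is absorbed since \<open>\<kappa>\<close> is
    small.\<close>
  have card: "real (card {- J - 1..J}) \<le> 1 / \<kappa>\<^sup>2"
  proof -
    have "of_int J \<le> 1 / (4 * \<kappa>\<^sup>2)"
      unfolding J_def by (rule of_int_floor_le)
    moreover have "\<kappa>\<^sup>2 \<le> (1 / 2)\<^sup>2"
      using \<kappa> by (intro power_mono) auto
    then have "2 \<le> 1 / (2 * \<kappa>\<^sup>2)"
      using \<kappa> by (simp add: field_simps power2_eq_square)
    ultimately show ?thesis
      using \<open>0 \<le> J\<close> by simp
  qed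
  \<comment> \<open>At most \<open>1 / \<kappa>\<^sup>2\<close> cells of measure at most
    \<open>A * (5 * s) ^ 3\<close> carry in total \<open>125 * A * \<kappa> * \<rho> ^ 3\<close>,
    too little for lower regularity.\<close>
  have "ennreal (\<rho> ^ 3 / A) \<le> hausdorff_measure 3 (E \<inter> ball p \<rho>)"
    by (rule three_regularD(1)[OF reg p \<open>0 < \<rho>\<close> diam])
  also have "\<dots> \<le> hausdorff_measure 3 (\<Union>j\<in>{- J - 1..J}. cell j)"
    by (rule hausdorff_measure_mono[OF cover])
  also have "\<dots> \<le> (\<Sum>j\<in>{- J - 1..J}. hausdorff_measure 3 (cell j))"
    by (rule hausdorff_measure_UN_le) simp
  also have "\<dots> \<le> (\<Sum>j\<in>{- J - 1..J}. ennreal (A * (5 * s) ^ 3))"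
    by (intro sum_mono cell_le)
  also have "\<dots> = ennreal (card {- J - 1..J} * (A * (5 * s) ^ 3))"
    using A s by (subst sum_ennreal) auto
  finally have "\<rho> ^ 3 / A \<le> card {- J - 1..J} * (A * (5 * s) ^ 3)"
    using A s by (subst (asm) ennreal_le_iff) auto
  also have "\<dots> \<le> 1 / \<kappa>\<^sup>2 * (A * (5 * s) ^ 3)"
    using A s by (intro mult_right_mono card) auto
  also have "\<dots> = 125 * A * \<kappa> * \<rho> ^ 3"
    using \<kappa> by (simp add: s_def field_simps power2_eq_square power3_eq_cube)
  finally have "\<rho> ^ 3 \<le> 125 * (A\<^sup>2 * \<kappa>) * \<rho> ^ 3"
    using A by (simp add: field_simps power2_eq_square)
  then show False
    using \<open>0 < \<rho>\<close> by (simp add: \<kappa>(3))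
qed

section \<open>Exactly symmetric sets\<close>

text \<open>The limiting form of \<open>symmetric_in_ball\<close> as \<tau> tends to zero, rescaled
  to the unit ball at the origin.\<close>

definition unit_symmetric :: "heis set \<Rightarrow> bool" where
  "unit_symmetric F \<longleftrightarrow> 1 \<in> F \<and>
     (\<forall>p\<in>F. \<forall>q\<in>F. heis_norm p < 1 \<longrightarrow> heis_norm q < 1 \<longrightarrow> symmetric_point p q \<in> F)"

text \<open>Bookkeeping for compositions: each symmetry about such a point costs 1/50 in norm, and
  stays available while the norm is below one.\<close>

lemma unit_symmetric_step:
  assumes F: "unit_symmetric F" and p: "p \<in> F" "heis_norm p \<le> 1 / 100"
    and q: "q \<in> F" "heis_norm q \<le> s" "s < 1"
  shows "symmetric_point p q \<in> F" and "heis_norm (symmetric_point p q) \<le> s + 1 / 50"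
  using F p q heis_norm_symmetric_point_le[of p q] unfolding unit_symmetric_def by auto

lemma heis_norm_combination_le:
  fixes k l :: real
  assumes "0 \<le> k" and "0 \<le> l"
  shows "heis_norm (Heis (2 * k * a\<^sub>1 + 2 * l * b\<^sub>1, 2 * k * a\<^sub>2 + 2 * l * b\<^sub>2, t)) \<le>
    2 * k * norm (a\<^sub>1, a\<^sub>2) + 2 * l * norm (b\<^sub>1, b\<^sub>2) + 2 * sqrt \<bar>t\<bar>"
proof -
  have "norm (2 * k * a\<^sub>1 + 2 * l * b\<^sub>1, 2 * k * a\<^sub>2 + 2 * l * b\<^sub>2) =
      norm ((2 * k) *\<^sub>R (a\<^sub>1, a\<^sub>2) + (2 * l) *\<^sub>R (b\<^sub>1, b\<^sub>2))"
    by simp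
  also have "\<dots> \<le> norm ((2 * k) *\<^sub>R (a\<^sub>1, a\<^sub>2)) + norm ((2 * l) *\<^sub>R (b\<^sub>1, b\<^sub>2))"
    by (rule norm_triangle_ineq)
  also have "\<dots> = 2 * k * norm (a\<^sub>1, a\<^sub>2) + 2 * l * norm (b\<^sub>1, b\<^sub>2)"
    using assms by (simp del: scaleR_Pair)
  finally show ?thesis
    using heis_norm_le[of "2 * k * a\<^sub>1 + 2 * l * b\<^sub>1" "2 * k * a\<^sub>2 + 2 * l * b\<^sub>2" t] by linarith
qed

text \<open>The point is the product of the \<open>k\<close>-th power of (2a, 0), the
  \<open>l\<close>-th power of (2b, 0) and the \<open>m\<close>-th power of their commutator (0, 0,
  4 \<omega>). The heights \<alpha> and \<beta> drop out because a symmetry depends only on the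
  projection of its centre. It is reached by raising \<open>l\<close>, then \<open>k\<close>, then
  \<open>m\<close>; the bound \<open>N\<close> is monotone in each index, so all intermediate points
  have norm at most 1/4.\<close>

lemma unit_symmetric_lattice:
  assumes F: "unit_symmetric F"
    and a: "Heis (a\<^sub>1, a\<^sub>2, \<alpha>) \<in> F" "heis_norm (Heis (a\<^sub>1, a\<^sub>2, \<alpha>)) \<le> 1 / 100"
    and b: "Heis (b\<^sub>1, b\<^sub>2, \<beta>) \<in> F" "heis_norm (Heis (b\<^sub>1, b\<^sub>2, \<beta>)) \<le> 1 / 100"
    and \<omega>: "\<omega> = a\<^sub>1 * b\<^sub>2 - a\<^sub>2 * b\<^sub>1" "0 \<le> \<omega>"
    and norm_le: "2 * real k * norm (a\<^sub>1, a\<^sub>2) + 2 * real l * norm (b\<^sub>1, b\<^sub>2)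
      + 2 * sqrt (2 * real k * real l * \<omega> + 4 * real m * \<omega>) \<le> 1 / 4"
  shows "Heis (2 * k * a\<^sub>1 + 2 * l * b\<^sub>1, 2 * k * a\<^sub>2 + 2 * l * b\<^sub>2, 2 * k * l * \<omega> + 4 * m * \<omega>) \<in> F"
proof -
  define P where "P k l m = Heis (2 * real k * a\<^sub>1 + 2 * real l * b\<^sub>1, 2 * real k * a\<^sub>2 + 2 * real l * b\<^sub>2,
    2 * real k * real l * \<omega> + 4 * real m * \<omega>)" for k l m
  define N where "N k l m = 2 * real k * norm (a\<^sub>1, a\<^sub>2) + 2 * real l * norm (b\<^sub>1, b\<^sub>2)
    + 2 * sqrt (2 * real k * real l * \<omega> + 4 * real m * \<omega>)" for k l m
  have P_le: "heis_norm (P k l m) \<le> N k l m" for k l m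
    unfolding P_def N_def using \<omega>(2) by (intro order_trans[OF heis_norm_combination_le]) auto
  have N_mono: "N k l m \<le> N k' l' m'" if "k \<le> k'" "l \<le> l'" "m \<le> m'" for k l m k' l' m'
    unfolding N_def using that \<omega>(2)
    by (intro add_mono mult_mono real_sqrt_le_mono) auto
  have one: "Heis (0, 0, 0) \<in> F" "heis_norm (Heis (0, 0, 0)) \<le> 1 / 100"
    using F by (simp_all add: unit_symmetric_def one_heis_def)
  note step = unit_symmetric_step[OF F]
  define S\<^sub>0 S\<^sub>a S\<^sub>b where
    "S\<^sub>0 = symmetric_point (Heis (0, 0, 0))"
    "S\<^sub>a = symmetric_point (Heis (a\<^sub>1, a\<^sub>2, \<alpha>))"
    "S\<^sub>b = symmetric_point (Heis (b\<^sub>1, b\<^sub>2, \<beta>))"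
  note S_def = S\<^sub>0_S\<^sub>a_S\<^sub>b_def
  note S = step[OF one, folded S_def] step[OF a, folded S_def] step[OF b, folded S_def]
  have l: "P 0 l 0 \<in> F" if "N 0 l 0 \<le> 1 / 4" for l
    using that
  proof (induction l)
    case 0
    then show ?case
      using one by (simp add: P_def)
  next
    case (Suc l)
    then have N: "N 0 l 0 \<le> 1 / 4"
      using N_mono[of 0 0 l "Suc l" 0 0] by simp
    then have q: "P 0 l 0 \<in> F" "heis_norm (P 0 l 0) \<le> 1 / 4"
      using Suc.IH P_le[of 0 l 0] by auto
    note q1 = S(1,2)[OF q]
    have "S\<^sub>b (S\<^sub>0 (P 0 l 0)) \<in> F"
      by (rule S(5)[OF q1]) simp_all
    also have "S\<^sub>b (S\<^sub>0 (P 0 l 0)) = P 0 (Suc l) 0"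
      by (simp add: S_def P_def symmetric_point_Heis algebra_simps)
    finally show ?case .
  qed
  have k: "P k l 0 \<in> F" if "N k l 0 \<le> 1 / 4" for k l
    using that
  proof (induction k)
    case 0
    then show ?case
      by (rule l)
  next
    case (Suc k)
    then have N: "N k l 0 \<le> 1 / 4"
      using N_mono[of k "Suc k" l l 0 0] by simp
    then have q: "P k l 0 \<in> F" "heis_norm (P k l 0) \<le> 1 / 4"
      using Suc.IH P_le[of k l 0] by auto
    note q1 = S(1,2)[OF q]
    have "S\<^sub>a (S\<^sub>0 (P k l 0)) \<in> F"
      by (rule S(3)[OF q1]) simp_all
    also have "S\<^sub>a (S\<^sub>0 (P k l 0)) = P (Suc k) l 0"
      by (simp add: S_def P_def \<omega>(1) symmetric_point_Heis algebra_simps)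
    finally show ?case .
  qed
  have m: "P k l m \<in> F" if "N k l m \<le> 1 / 4" for k l m
    using that
  proof (induction m)
    case 0
    then show ?case
      by (rule k)
  next
    case (Suc m)
    then have N: "N k l m \<le> 1 / 4"
      using N_mono[of k k l l m "Suc m"] by simp
    then have q: "P k l m \<in> F" "heis_norm (P k l m) \<le> 1 / 4"
      using Suc.IH P_le[of k l m] by auto
    \<comment> \<open>Six symmetries about points of norm at most 1/100, each raising the bound by
      1/50, keep every input inside the unit ball.\<close>
    have "1/4 < (1::real)" "1/4 + 1/50 < (1::real)" "1/4 + 1/50 + 1/50 < (1::real)"
      "1/4 + 1/50 + 1/50 + 1/50 < (1::real)" "1/4 + 1/50 + 1/50 + 1/50 + 1/50 < (1::real)"
      "1/4 + 1/50 + 1/50 + 1/50 + 1/50 + 1/50 < (1::real)"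
      by simp_all
    note lt = this
    note q1 = S(5,6)[OF q lt(1)]
    note q2 = S(1,2)[OF q1 lt(2)]
    note q3 = S(3,4)[OF q2 lt(3)]
    note q4 = S(5,6)[OF q3 lt(4)]
    note q5 = S(1,2)[OF q4 lt(5)]
    note q6 = S(3,4)[OF q5 lt(6)]
    \<comment> \<open>the commutator of the translations by \<open>(2a, 0)\<close> and \<open>(2b, 0)\<close>\<close>
    have "S\<^sub>a (S\<^sub>0 (S\<^sub>b (S\<^sub>a (S\<^sub>0 (S\<^sub>b (P k l m)))))) = P k l (Suc m)"
      by (simp add: S_def P_def \<omega>(1) symmetric_point_Heis algebra_simps)
    with q6(1) show ?case
      by simp
  qed
  show ?thesis
    using m[of k l m] norm_le by (simp add: P_def N_def)
qed


lemma real_floor_approx: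
  fixes x :: real
  assumes "0 < x" and "0 < y"
  shows "\<exists>n. real n * x \<le> y \<and> y < (real n + 1) * x"
proof -
  define n where "n = nat \<lfloor>y / x\<rfloor>"
  have "0 \<le> y / x"
    using assms by simp
  then have "real n \<le> y / x" "y / x < real n + 1"
    unfolding n_def by linarith+
  then show ?thesis
    using assms by (intro exI[of _ n]) (simp add: field_simps)
qed

text \<open>
  The spacing \<open>\<delta>\<close> is the distance \<open>4 sqrt \<omega>\<close> between consecutive lattice points on a vertical
  line. The steps along \<open>a\<close> are finer than that, so only every \<open>K\<close>-th of them is kept; the
  translates in the direction of \<open>b\<close> are \<open>1/c\<close> many, which is what exceeds \<open>3\<close>-regularity.
\<close>

lemma unit_symmetric_many_points:
  assumes F: "unit_symmetric F"
    and a: "Heis (a\<^sub>1, a\<^sub>2, \<alpha>) \<in> F" "heis_norm (Heis (a\<^sub>1, a\<^sub>2, \<alpha>)) \<le> 1 / 100"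
    and b: "Heis (b\<^sub>1, b\<^sub>2, \<beta>) \<in> F" "heis_norm (Heis (b\<^sub>1, b\<^sub>2, \<beta>)) \<le> c"
    and c: "0 < c" "c \<le> 1 / 100"
    and \<omega>: "\<omega> = a\<^sub>1 * b\<^sub>2 - a\<^sub>2 * b\<^sub>1" "0 < \<omega>" "4 * (norm (a\<^sub>1, a\<^sub>2))\<^sup>2 \<le> \<omega>"
  obtains S and \<delta> :: real and w where "finite S" "S \<subseteq> F" "\<forall>q\<in>S. heis_norm q \<le> 1 / 32"
    and "0 < \<delta>" "\<delta> \<le> 1 / 16" "\<forall>p\<in>S. \<forall>q\<in>S. p \<noteq> q \<longrightarrow> \<delta> \<le> dist p q"
    and "1 < 2 ^ 29 * c * (card S * \<delta> ^ 3)"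
    and "w \<in> F" "1 / 8 < heis_norm w"
proof -
  define na nb where "na = norm (a\<^sub>1, a\<^sub>2)" "nb = norm (b\<^sub>1, b\<^sub>2)"
  note n_def = na_nb_def
  have "\<omega> \<le> na * nb"
    using abs_cross_le[of a\<^sub>1 b\<^sub>2 a\<^sub>2 b\<^sub>1] by (simp add: \<omega>(1) n_def norm_Pair add.commute)
  moreover have "0 \<le> na" "0 \<le> nb"
    by (simp_all add: n_def)
  ultimately have pos: "0 < na" "0 < nb"
    using \<omega>(2) zero_less_mult_iff[of na nb] by auto
  have le: "na \<le> 1 / 100" "nb \<le> c"
    using norm_heis_proj_le[of "Heis (a\<^sub>1, a\<^sub>2, \<alpha>)"] norm_heis_proj_le[of "Heis (b\<^sub>1, b\<^sub>2, \<beta>)"] a b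
    by (simp_all add: n_def del: heis_norm.simps)
  have b': "heis_norm (Heis (b\<^sub>1, b\<^sub>2, \<beta>)) \<le> 1 / 100"
    using b c by linarith
  note lattice = unit_symmetric_lattice[OF F a b(1) b' \<omega>(1) less_imp_le[OF \<omega>(2)], folded n_def]
  define \<delta> where "\<delta> = 4 * sqrt \<omega>"
  have \<delta>: "0 < \<delta>" "\<delta>\<^sup>2 = 16 * \<omega>"
    using \<omega>(2) by (simp_all add: \<delta>_def power_mult_distrib)
  have "\<omega> \<le> (1 / 100) * (1 / 100)"
    using \<open>\<omega> \<le> na * nb\<close> le c pos mult_mono[of na "1 / 100" nb "1 / 100"] by simp
  then have "\<delta>\<^sup>2 \<le> (1 / 16)\<^sup>2"
    using \<delta>(2) by (simp add: power2_eq_square)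
  then have \<delta>_le: "\<delta> \<le> 1 / 16"
    by (rule power2_le_imp_le) simp
  have na_\<delta>: "8 * na \<le> \<delta>"
    by (rule power2_le_imp_le) (use \<delta> \<omega>(3) in \<open>auto simp: power_mult_distrib n_def\<close>)
  \<comment> \<open>Translation by 2b moves the projection away from a line parallel to a by
    \<open>2 * \<omega> / na\<close>; this is at least \<open>\<delta>\<close>.\<close>
  have \<omega>_\<delta>: "na * \<delta> \<le> 2 * \<omega>"
  proof -
    have "8 * na * \<delta> \<le> \<delta> * \<delta>"
      using na_\<delta> \<delta> by (intro mult_right_mono) auto
    then show ?thesis
      using \<delta>(2) by (simp add: power2_eq_square mult.commute)
  qed
  obtain K' where K': "real K' * (2 * na) \<le> \<delta>" "\<delta> < (real K' + 1) * (2 * na)"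
    using real_floor_approx[of "2 * na" \<delta>] pos \<delta> by auto
  \<comment> \<open>The smallest multiple for which the step \<open>2 * K * na\<close> exceeds
    \<open>\<delta>\<close>. Since \<open>na\<close> is at most \<open>\<delta> / 8\<close>, it
    overshoots so little that \<open>K * na \<le> \<delta>\<close> holds as well.\<close>
  define K where "K = Suc K'"
  have K: "\<delta> \<le> 2 * K * na" "K * na \<le> \<delta>" "0 < K"
    using K' na_\<delta> by (simp_all add: K_def algebra_simps)
  have Kna: "0 < K * na"
    using K pos by simp
  \<comment> \<open>The budgets 1/256, 1/256 and 2^-15 are balanced: the horizontal parts contribute
    1/128 each, and the height is at most (1/128)^2, contributing 1/64. The total is 1/32.\<close>
  obtain I where I: "real I * (K * na) \<le> 1 / 256" "1 / 256 < (real I + 1) * (K * na)"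
    using real_floor_approx[of "K * na" "1 / 256"] Kna by auto
  obtain L where L: "real L * nb \<le> 1 / 256" "1 / 256 < (real L + 1) * nb"
    using real_floor_approx[of nb "1 / 256"] pos by auto
  obtain M where M: "real M * (4 * \<omega>) \<le> 1 / 2 ^ 15" "1 / 2 ^ 15 < (real M + 1) * (4 * \<omega>)"
    using real_floor_approx[of "4 * \<omega>" "1 / 2 ^ 15"] \<omega>(2) by auto
  define G where "G = {..I} \<times> {..L} \<times> {..M}"
  define f where "f = (\<lambda>(i, l, m). Heis (2 * real (K * i) * a\<^sub>1 + 2 * real l * b\<^sub>1,
    2 * real (K * i) * a\<^sub>2 + 2 * real l * b\<^sub>2, 2 * real (K * i) * real l * \<omega> + 4 * real m * \<omega>))"
  have bound: "2 * real (K * i) * na + 2 * real l * nb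
      + 2 * sqrt (2 * real (K * i) * real l * \<omega> + 4 * real m * \<omega>) \<le> 1 / 32"
    if "i \<le> I" "l \<le> L" "m \<le> M" for i l m
  proof -
    have i: "real i * (K * na) \<le> 1 / 256"
      using that Kna by (intro order_trans[OF mult_right_mono I(1)]) auto
    have l: "real l * nb \<le> 1 / 256"
      using that pos by (intro order_trans[OF mult_right_mono L(1)]) auto
    have m: "real m * (4 * \<omega>) \<le> 1 / 2 ^ 15"
      using that \<omega>(2) by (intro order_trans[OF mult_right_mono M(1)]) auto
    have "real (K * i) * real l * \<omega> \<le> real (K * i) * real l * (na * nb)"
      using \<open>\<omega> \<le> na * nb\<close> by (intro mult_left_mono) auto
    also have "\<dots> = (real i * (K * na)) * (real l * nb)"
      by simp
    also have "\<dots> \<le> 1 / 256 * (1 / 256)"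
      using i l pos Kna by (intro mult_mono) auto
    finally have "2 * real (K * i) * real l * \<omega> + 4 * real m * \<omega> \<le> (1 / 128)\<^sup>2"
      using m by (simp add: power2_eq_square)
    then have "sqrt (2 * real (K * i) * real l * \<omega> + 4 * real m * \<omega>) \<le> 1 / 128"
      by (intro real_le_lsqrt) auto
    with i l show ?thesis
      by (simp add: algebra_simps)
  qed
  have f_mem: "f x \<in> F" and f_le: "heis_norm (f x) \<le> 1 / 32" if "x \<in> G" for x
  proof -
    obtain i l m where x: "x = (i, l, m)" "i \<le> I" "l \<le> L" "m \<le> M"
      using \<open>x \<in> G\<close> by (auto simp: G_def)
    note le = bound[OF x(2-4)]
    show "f x \<in> F"
      unfolding x f_def prod.case by (rule lattice) (use le in linarith)
    have "heis_norm (f x) \<le> 2 * real (K * i) * na + 2 * real l * nb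
      + 2 * sqrt \<bar>2 * real (K * i) * real l * \<omega> + 4 * real m * \<omega>\<bar>"
      unfolding x f_def prod.case n_def by (rule heis_norm_combination_le) simp_all
    with le show "heis_norm (f x) \<le> 1 / 32"
      using \<omega>(2) by simp
  qed
  obtain n where n: "real n * nb \<le> 1 / 16" "1 / 16 < (real n + 1) * nb"
    using real_floor_approx[of nb "1 / 16"] pos by auto
  \<comment> \<open>A point of \<open>F\<close> at distance more than 1/8 along b. It will force the
    diameter to be large enough for the regularity bounds.\<close>
  define w where "w = Heis (2 * real (Suc n) * b\<^sub>1, 2 * real (Suc n) * b\<^sub>2, 0)"
  show ?thesis
  proof (rule that[of "f ` G" \<delta> w])
    show "finite (f ` G)"
      by (simp add: G_def)
    show "f ` G \<subseteq> F"
      using f_mem by blast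
    show "\<forall>q\<in>f ` G. heis_norm q \<le> 1 / 32"
      using f_le by blast
    show "0 < \<delta>" "\<delta> \<le> 1 / 16"
      by fact+
    have sep: "\<delta> \<le> dist (f x) (f y)" if "x \<in> G" "y \<in> G" "x \<noteq> y" for x y
    proof -
      obtain i l m where x: "x = (i, l, m)"
        by (cases x)
      obtain i' l' m' where y: "y = (i', l', m')"
        by (cases y)
      define u v where "u = 2 * (real (K * i) - real (K * i'))" "v = 2 * (real l - real l')"
      have proj: "norm (u * a\<^sub>1 + v * b\<^sub>1, u * a\<^sub>2 + v * b\<^sub>2) \<le> dist (f x) (f y)"
        using norm_heis_proj_diff_le[of "f x" "f y"]
        by (simp add: x y f_def u_v_def algebra_simps)
      \<comment> \<open>Different \<open>l\<close> are separated across the direction of a, equal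
        \<open>l\<close> with different \<open>i\<close> along it; otherwise the difference is
        purely vertical.\<close>
      consider "l \<noteq> l'" | "l = l'" "i \<noteq> i'" | "l = l'" "i = i'" "m \<noteq> m'"
        using \<open>x \<noteq> y\<close> x y by auto
      then show ?thesis
      proof cases
        case 1
        have "1 \<le> \<bar>real l - real l'\<bar>"
          using 1 by linarith
        then have "2 \<le> \<bar>v\<bar>"
          by (simp add: u_v_def abs_mult)
        then have "2 * \<omega> \<le> \<bar>v\<bar> * \<omega>"
          using \<omega>(2) by simp
        \<comment> \<open>The determinant with a annihilates the multiple of a in the difference and
          turns the multiple of b into a multiple of \<open>\<omega>\<close>.\<close>
        also have "\<dots> = \<bar>a\<^sub>1 * (u * a\<^sub>2 + v * b\<^sub>2) - a\<^sub>2 * (u * a\<^sub>1 + v * b\<^sub>1)\<bar>"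
        proof -
          have "a\<^sub>1 * (u * a\<^sub>2 + v * b\<^sub>2) - a\<^sub>2 * (u * a\<^sub>1 + v * b\<^sub>1) = v * \<omega>"
            by (simp add: \<omega>(1) algebra_simps)
          then show ?thesis
            using \<omega>(2) by (simp add: abs_mult)
        qed
        also have "\<dots> \<le> na * norm (u * a\<^sub>1 + v * b\<^sub>1, u * a\<^sub>2 + v * b\<^sub>2)"
          using abs_cross_le by (simp add: n_def)
        also have "\<dots> \<le> na * dist (f x) (f y)"
          using proj pos by (intro mult_left_mono) auto
        finally have "na * \<delta> \<le> na * dist (f x) (f y)"
          using \<omega>_\<delta> by linarith
        then show ?thesis
          using pos by simp
      next
        case 2
        have "1 \<le> \<bar>real i - real i'\<bar>"
          using 2 by linarith
        then have "2 * real K * na * 1 \<le> 2 * real K * na * \<bar>real i - real i'\<bar>"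
          using pos by (intro mult_left_mono) auto
        also have "\<dots> = \<bar>u\<bar> * na"
          by (simp add: u_v_def abs_mult flip: right_diff_distrib)
        also have "\<dots> = norm (u *\<^sub>R (a\<^sub>1, a\<^sub>2))"
          unfolding norm_scaleR n_def ..
        also have "\<dots> \<le> dist (f x) (f y)"
          using proj 2 by (simp add: u_v_def)
        finally show ?thesis
          using K(1) by simp
      next
        case 3
        define d where "d = 4 * real m * \<omega> - 4 * real m' * \<omega>"
        have "1 \<le> \<bar>real m - real m'\<bar>"
          using 3 by linarith
        then have "4 * \<omega> * 1 \<le> 4 * \<omega> * \<bar>real m - real m'\<bar>"
          using \<omega>(2) by (intro mult_left_mono) auto
        also have "\<dots> = \<bar>d\<bar>"
        proof -
          have "d = 4 * \<omega> * (real m - real m')"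
            by (simp add: d_def algebra_simps)
          then show ?thesis
            using \<omega>(2) by (simp add: abs_mult)
        qed
        finally have "\<delta>\<^sup>2 \<le> 4 * \<bar>d\<bar>"
          using \<delta>(2) by simp
        also have "dist (f x) (f y) = heis_norm (Heis (0, 0, d))"
          using 3 by (simp add: x y f_def dist_Heis d_def algebra_simps del: heis_norm.simps)
        then have "4 * \<bar>d\<bar> \<le> (dist (f x) (f y))\<^sup>2"
          using heis_norm_vertical_le[of d 0 0] by (simp del: heis_norm.simps)
        finally show ?thesis
          by (rule power2_le_imp_le) simp
      qed
    qed
    show "\<forall>p\<in>f ` G. \<forall>q\<in>f ` G. p \<noteq> q \<longrightarrow> \<delta> \<le> dist p q"
      using sep by blast
    have "inj_on f G"
      using sep \<delta>(1) by (intro inj_onI) (metis dist_self not_le)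
    then have card: "real (card (f ` G)) = (real I + 1) * ((real L + 1) * (real M + 1))"
      by (simp add: card_image G_def algebra_simps)
    \<comment> \<open>The three maximality conditions multiply to 2^-31. Replacing
      \<open>K * na\<close> by \<open>\<delta>\<close>, \<open>nb\<close> by \<open>c\<close> and
      \<open>4 * \<omega>\<close> by \<open>\<delta>\<^sup>2 / 4\<close> turns the product into a
      count times \<open>c * \<delta> ^ 3 / 4\<close>.\<close>
    have "1 / 256 * (1 / 256 * (1 / 2 ^ 15)) <
        ((real I + 1) * (K * na)) * (((real L + 1) * nb) * ((real M + 1) * (4 * \<omega>)))"
      by (intro mult_strict_mono I L M mult_pos_pos mult_nonneg_nonneg)
        (use K(3) pos \<omega>(2) in auto)
    also have "\<dots> \<le> ((real I + 1) * \<delta>) * (((real L + 1) * c) * ((real M + 1) * (\<delta>\<^sup>2 / 4)))"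
      using K(2) le pos \<delta> \<omega>(2) by (intro mult_mono mult_nonneg_nonneg order_refl) auto
    also have "\<dots> = c * (card (f ` G) * \<delta> ^ 3) / 4"
      unfolding card by (simp add: power2_eq_square power3_eq_cube)
    finally show "1 < 2 ^ 29 * c * (card (f ` G) * \<delta> ^ 3)"
      by simp
    show "w \<in> F"
      using lattice[of 0 "Suc n" 0] n(1) le c by (simp add: w_def algebra_simps)
    have "1 / 8 < norm ((2 * real (Suc n)) *\<^sub>R (b\<^sub>1, b\<^sub>2))"
      using n(2) unfolding norm_scaleR n_def by (simp add: algebra_simps)
    then show "1 / 8 < heis_norm w"
      unfolding w_def heis_norm_horizontal by simp
  qed
qed

section \<open>Rescaling and limits\<close>

definition rescale :: "heis \<Rightarrow> real \<Rightarrow> heis \<Rightarrow> heis" where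
  "rescale p r q = p * heis_dil r q"

lemma rescale_one: "rescale p r 1 = p"
  by (cases p) (simp add: rescale_def one_heis_def)

lemma dist_rescale: "0 \<le> r \<Longrightarrow> dist (rescale p r x) (rescale p r y) = r * dist x y"
  by (simp add: rescale_def dist_heis_mult_left dist_heis_dil)

lemma dist_rescale_center: "0 \<le> r \<Longrightarrow> dist p (rescale p r q) = r * heis_norm q"
  using dist_rescale[of r p 1 q] by (simp add: rescale_one dist_commute[of 1] dist_heis_one)

lemma symmetric_point_rescale:
  "symmetric_point (rescale p r x) (rescale p r y) = rescale p r (symmetric_point x y)"
  by (simp add: rescale_def symmetric_point_mult_left symmetric_point_dil)

lemma rescale_surj:
  assumes "0 < r"
  obtains q where "x = rescale p r q"
proof
  have "heis_dil r (heis_dil (1 / r) q) = q" for q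
    using assms by (cases q) (simp add: power2_eq_square)
  then have "rescale p r (heis_dil (1 / r) (inverse p * x)) = p * (inverse p * x)"
    by (simp add: rescale_def)
  also have "\<dots> = x"
    by (metis heis_right_inverse mult.assoc mult_1_left)
  finally show "x = rescale p r (heis_dil (1 / r) (inverse p * x))" ..
qed

lemma rescale_symmetric:
  assumes sym: "symmetric_in_ball \<tau> E p r" and "0 < \<tau>" "0 < r"
    and x: "rescale p r x \<in> E" "heis_norm x < 1" and y: "rescale p r y \<in> E" "heis_norm y < 1"
  obtains x' z where "dist x' x < \<tau>" "rescale p r z \<in> E" "dist (symmetric_point x' y) z < 2 * \<tau>"
proof -
  have "rescale p r x \<in> E \<inter> ball p r" "rescale p r y \<in> E \<inter> ball p r"
    using x y \<open>0 < r\<close> by (simp_all add: dist_rescale_center)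
  then obtain u where u: "u \<in> E \<inter> ball (rescale p r x) (r * \<tau>)"
    and inf: "infdist (symmetric_point u (rescale p r y)) E \<le> \<tau> * r"
    using sym unfolding symmetric_in_ball_def by blast
  obtain x' where x': "u = rescale p r x'"
    using \<open>0 < r\<close> by (rule rescale_surj)
  \<comment> \<open>The factor 2 makes the inequality strict, so that an actual point of
    \<open>E\<close> realises it.\<close>
  have "infdist (rescale p r (symmetric_point x' y)) E < 2 * \<tau> * r"
    using inf \<open>0 < \<tau>\<close> \<open>0 < r\<close> mult_pos_pos[of \<tau> r] unfolding x' symmetric_point_rescale by linarith
  moreover have "E \<noteq> {}"
    using u by blast
  ultimately obtain e where e: "e \<in> E" "dist (rescale p r (symmetric_point x' y)) e < 2 * \<tau> * r"
    using cInf_lessD[of "dist (rescale p r (symmetric_point x' y)) ` E" "2 * \<tau> * r"]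
    by (auto simp: infdist_notempty)
  obtain z where z: "e = rescale p r z"
    using \<open>0 < r\<close> by (rule rescale_surj)
  show ?thesis
  proof
    show "dist x' x < \<tau>"
      using u \<open>0 < r\<close> by (simp add: x' dist_rescale dist_commute)
    show "rescale p r z \<in> E"
      using e z by simp
    show "dist (symmetric_point x' y) z < 2 * \<tau>"
      using e \<open>0 < r\<close> by (simp add: z dist_rescale)
  qed
qed

text \<open>The packing bound at radius \<open>r / 16\<close>, where 512 / 16^3 = 1/8. The point
  \<open>w\<close> makes the diameter of \<open>E\<close> at least \<open>r / 8\<close>, as that
  bound requires.\<close>

lemma rescale_card_separated:
  fixes A r \<delta> :: real
  assumes reg: "three_regular A E" and p: "p \<in> E" and "0 < r"
    and S: "finite S" "\<And>q. q \<in> S \<Longrightarrow> rescale p r q \<in> E" "\<And>q. q \<in> S \<Longrightarrow> heis_norm q < 1 / 16"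
    and sep: "\<And>x y. x \<in> S \<Longrightarrow> y \<in> S \<Longrightarrow> x \<noteq> y \<Longrightarrow> \<delta> \<le> dist x y"
    and \<delta>: "0 < \<delta>" "\<delta> \<le> 1 / 16"
    and w: "rescale p r w \<in> E" "1 / 8 \<le> heis_norm w"
  shows "card S * \<delta> ^ 3 \<le> A\<^sup>2 / 8"
proof -
  have inj: "inj_on (rescale p r) S"
    using \<open>0 < r\<close> dist_rescale[of r p] by (intro inj_onI) (metis dist_eq_0_iff less_imp_le mult_eq_0_iff not_less_iff_gr_or_eq)
  have "card (rescale p r ` S) * (r * \<delta>) ^ 3 \<le> 512 * A\<^sup>2 * (r / 16) ^ 3"
  proof (rule three_regular_card_separated[OF reg p])
    show "2 * (r / 16) \<le> diameter E" if "bounded E"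
    proof -
      have "r * (1 / 8) \<le> r * heis_norm w"
        using w \<open>0 < r\<close> by (intro mult_left_mono) auto
      also have "\<dots> = dist p (rescale p r w)"
        using \<open>0 < r\<close> by (simp add: dist_rescale_center)
      also have "\<dots> \<le> diameter E"
        using that p w(1) by (rule diameter_bounded_bound)
      finally show ?thesis
        by simp
    qed
    show "finite (rescale p r ` S)"
      using S by simp
    show "rescale p r ` S \<subseteq> E \<inter> ball p (r / 16)"
      using S \<open>0 < r\<close> by (auto simp: dist_rescale_center)
    show "r * \<delta> \<le> dist x y" if "x \<in> rescale p r ` S" "y \<in> rescale p r ` S" "x \<noteq> y" for x y
      using that \<open>0 < r\<close> by (auto simp: dist_rescale intro!: sep)
    show "0 < r * \<delta>" "r * \<delta> \<le> r / 16"
      using \<delta> \<open>0 < r\<close> by (simp_all add: field_simps)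
  qed
  then show ?thesis
    using \<open>0 < r\<close> by (simp add: card_image[OF inj] power_mult_distrib field_simps)
qed

section \<open>Vertical planes and points far from them\<close>

fun heis_cross :: "heis \<Rightarrow> heis \<Rightarrow> real" where
  "heis_cross (Heis (x, y, t)) (Heis (u, v, s)) = x * v - y * u"

lemma vertical_planeI:
  assumes "(e\<^sub>1, e\<^sub>2) \<noteq> (0, 0 :: real)"
  shows "vertical_plane ((\<lambda>v. p * Heis v) ` span {(e\<^sub>1, e\<^sub>2, 0), (0, 0, 1)})"
proof -
  let ?B = "{(e\<^sub>1, e\<^sub>2, 0), (0, 0, 1)} :: (real \<times> real \<times> real) set"
  have "(e\<^sub>1, e\<^sub>2, 0) \<notin> span {(0, 0, 1 :: real)}"
    using assms by (auto simp: span_singleton)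
  then have "independent ?B"
    by (simp add: independent_insert zero_prod_def)
  then have "dim (span ?B) = 2"
    using assms by (subst dim_span_eq_card_independent) auto
  moreover have "(0, 0, t) \<in> span ?B" for t
    using span_scale[OF span_base[of "(0, 0, 1)" ?B], of t] by simp
  ultimately show ?thesis
    unfolding vertical_plane_def by blast
qed

text \<open>The infimum is tested on the vertical plane through \<open>p\<close> in the direction of
  the projection of \<open>a\<close>. Up to the factor \<open>norm (heis_proj a)\<close>, the
  determinant is the Euclidean distance from the projection of \<open>y\<close> to the line spanned
  by that of \<open>a\<close>, which bounds the distance to the plane from above.\<close>

lemma vertical_beta_far_point:
  assumes "0 < \<epsilon>" "0 < s" and beta: "ennreal \<epsilon> \<le> vertical_beta E p s"
    and a: "heis_proj a \<noteq> 0"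
  obtains y where "p * y \<in> E" "heis_norm y < s" "\<epsilon> / 2 * s * norm (heis_proj a) \<le> \<bar>heis_cross a y\<bar>"
proof -
  obtain e\<^sub>1 e\<^sub>2 t where e: "a = Heis (e\<^sub>1, e\<^sub>2, t)"
    by (cases a)
  have e0: "(e\<^sub>1, e\<^sub>2) \<noteq> (0, 0)"
    using a by (simp add: e zero_prod_def)
  let ?B = "{(e\<^sub>1, e\<^sub>2, 0), (0, 0, 1)} :: (real \<times> real \<times> real) set"
  define W where "W = (\<lambda>v. p * Heis v) ` span ?B"
  \<comment> \<open>Half of \<open>\<epsilon>\<close> is given up because the supremum need not be
    attained.\<close>
  have "ennreal (\<epsilon> / 2) < ennreal \<epsilon>"
    using \<open>0 < \<epsilon>\<close> by (simp add: ennreal_less_iff)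
  also have "\<dots> \<le> (SUP y \<in> ball p s \<inter> E. ennreal (infdist y W / s))"
    using beta unfolding vertical_beta_def
    by (rule order_trans) (auto intro!: INF_lower vertical_planeI[OF e0] simp: W_def)
  finally obtain z where z: "z \<in> ball p s \<inter> E" and "ennreal (\<epsilon> / 2) < ennreal (infdist z W / s)"
    unfolding less_SUP_iff by blast
  then have far: "\<epsilon> / 2 * s < infdist z W"
    using \<open>0 < \<epsilon>\<close> \<open>0 < s\<close> by (simp add: ennreal_less_iff field_simps)
  obtain x y u where xyu: "inverse p * z = Heis (x, y, u)"
    by (cases "inverse p * z")
  have z_eq: "z = p * Heis (x, y, u)"
    unfolding xyu[symmetric] by (metis heis_right_inverse mult.assoc mult_1_left)
  define N where "N = norm (e\<^sub>1, e\<^sub>2)"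
  have N: "0 < N" "N\<^sup>2 = e\<^sub>1\<^sup>2 + e\<^sub>2\<^sup>2"
    using e0 by (auto simp: N_def norm_Pair sum_power2_gt_zero_iff)
  \<comment> \<open>\<open>\<mu>\<close> gives the orthogonal projection onto the line, and
    \<open>v\<close> is the height that cancels the vertical part of the difference, leaving a
    horizontal distance.\<close>
  define \<mu> where "\<mu> = (x * e\<^sub>1 + y * e\<^sub>2) / N\<^sup>2"
  define v where "v = u - 1/2 * (\<mu> * e\<^sub>1 * y - \<mu> * e\<^sub>2 * x)"
  have "\<mu> *\<^sub>R (e\<^sub>1, e\<^sub>2, 0) + v *\<^sub>R (0, 0, 1) \<in> span ?B"
    by (intro span_add span_scale span_base) auto
  then have "p * Heis (\<mu> * e\<^sub>1, \<mu> * e\<^sub>2, v) \<in> W"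
    by (simp add: W_def)
  then have "infdist z W \<le> dist z (p * Heis (\<mu> * e\<^sub>1, \<mu> * e\<^sub>2, v))"
    by (rule infdist_le)
  also have "\<dots> = norm (x - \<mu> * e\<^sub>1, y - \<mu> * e\<^sub>2)"
    unfolding z_eq dist_heis_mult_left dist_Heis heis_norm_horizontal[symmetric] by (simp add: v_def)
  finally have "\<epsilon> / 2 * s * N \<le> norm (x - \<mu> * e\<^sub>1, y - \<mu> * e\<^sub>2) * N"
    using far N by (intro mult_right_mono) auto
  also have "\<dots> = \<bar>e\<^sub>1 * y - e\<^sub>2 * x\<bar>"
  \<comment> \<open>Pythagoras followed by the Lagrange identity in the plane.\<close>
  proof (rule power2_eq_imp_eq)
    have "(norm (x - \<mu> * e\<^sub>1, y - \<mu> * e\<^sub>2) * N)\<^sup>2 =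
        (x\<^sup>2 + y\<^sup>2) * N\<^sup>2 - 2 * (\<mu> * N\<^sup>2) * (x * e\<^sub>1 + y * e\<^sub>2) + (\<mu> * N\<^sup>2) * \<mu> * (e\<^sub>1\<^sup>2 + e\<^sub>2\<^sup>2)"
      by (simp add: norm_Pair power_mult_distrib) (simp add: power2_eq_square algebra_simps)
    also have "\<mu> * N\<^sup>2 = x * e\<^sub>1 + y * e\<^sub>2"
      using N(1) by (simp add: \<mu>_def)
    also have "(x * e\<^sub>1 + y * e\<^sub>2) * \<mu> * (e\<^sub>1\<^sup>2 + e\<^sub>2\<^sup>2) = (x * e\<^sub>1 + y * e\<^sub>2) * (x * e\<^sub>1 + y * e\<^sub>2)"
      using N by (simp add: \<mu>_def flip: N(2))
    finally show "(norm (x - \<mu> * e\<^sub>1, y - \<mu> * e\<^sub>2) * N)\<^sup>2 = \<bar>e\<^sub>1 * y - e\<^sub>2 * x\<bar>\<^sup>2"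
      unfolding N(2) by (simp add: power2_eq_square algebra_simps)
  qed (use N in auto)
  finally have "\<epsilon> / 2 * s * N \<le> \<bar>e\<^sub>1 * y - e\<^sub>2 * x\<bar>" .
  moreover have "heis_norm (Heis (x, y, u)) < s"
    using z unfolding xyu[symmetric] by (simp add: dist_heis_def[symmetric] dist_commute)
  ultimately show ?thesis
    using z z_eq by (intro that[of "Heis (x, y, u)"]) (auto simp: e N_def simp del: heis_norm.simps)
qed

text \<open>For nonempty sets \<open>X n\<close> this is the lower Kuratowski limit.\<close>

definition limit_set :: "(nat \<Rightarrow> heis set) \<Rightarrow> heis set" where
  "limit_set X = {q. \<exists>e. (\<forall>n. e n \<in> X n) \<and> e \<longlonglongrightarrow> q}"

lemma limit_setI: "(\<And>n. e n \<in> X n) \<Longrightarrow> e \<longlonglongrightarrow> q \<Longrightarrow> q \<in> limit_set X"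
  unfolding limit_set_def by blast

lemma limit_setE:
  assumes "q \<in> limit_set X"
  obtains e where "\<And>n. e n \<in> X n" "e \<longlonglongrightarrow> q"
  using assms unfolding limit_set_def by blast

lemma tendsto_heis_norm: "(X \<longlongrightarrow> l) F \<Longrightarrow> ((\<lambda>n. heis_norm (X n)) \<longlongrightarrow> heis_norm l) F"
  unfolding dist_heis_one[symmetric] by (intro tendsto_intros)

lemma heis_proj_conv_coords: "heis_proj p = (fst (coords p), fst (snd (coords p)))"
  by (cases p) simp

lemma tendsto_heis_proj: "(X \<longlongrightarrow> l) F \<Longrightarrow> ((\<lambda>n. heis_proj (X n)) \<longlongrightarrow> heis_proj l) F"
  unfolding heis_proj_conv_coords by (intro tendsto_intros tendsto_coords)

lemma tendsto_heis_cross: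
  assumes "(X \<longlongrightarrow> p) F" and "(Y \<longlongrightarrow> q) F"
  shows "((\<lambda>n. heis_cross (X n) (Y n)) \<longlongrightarrow> heis_cross p q) F"
proof -
  have "heis_cross a b = fst (heis_proj a) * snd (heis_proj b) - snd (heis_proj a) * fst (heis_proj b)"
    for a b
    by (cases a; cases b) simp
  then show ?thesis
    using assms by (simp add: tendsto_intros tendsto_heis_proj)
qed

lemma tendsto_transform_dist:
  fixes f g :: "'a \<Rightarrow> 'b::metric_space"
  assumes "((\<lambda>n. dist (f n) (g n)) \<longlongrightarrow> 0) F" and "(g \<longlongrightarrow> l) F"
  shows "(f \<longlongrightarrow> l) F"
proof -
  have "((\<lambda>n. dist (f n) (g n) + dist (g n) l) \<longlongrightarrow> 0) F"
    using tendsto_add[OF assms(1) tendsto_dist_iff[THEN iffD1, OF assms(2)]] by simp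
  then have "((\<lambda>n. dist (f n) l) \<longlongrightarrow> 0) F"
    by (rule Lim_null_comparison[rotated]) (auto intro: always_eventually dist_triangle)
  then show ?thesis
    by (rule tendsto_dist_iff[THEN iffD2])
qed

text \<open>Approximants of \<open>p\<close> and \<open>q\<close> eventually lie in the open unit
  ball. There the corrected centres \<open>e' n\<close> still tend to \<open>p\<close>, and
  continuity of \<open>symmetric_point\<close> identifies the limit of the nearby points
  \<open>z n\<close>.\<close>

lemma unit_symmetric_limit_set:
  assumes one: "\<And>n. 1 \<in> X n" and \<tau>: "\<tau> \<longlonglongrightarrow> 0"
    and sym: "\<And>n p q. p \<in> X n \<Longrightarrow> heis_norm p < 1 \<Longrightarrow> q \<in> X n \<Longrightarrow> heis_norm q < 1 \<Longrightarrow>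
      \<exists>p' z. dist p' p < \<tau> n \<and> z \<in> X n \<and> dist (symmetric_point p' q) z < 2 * \<tau> n"
  shows "unit_symmetric (limit_set X)"
  unfolding unit_symmetric_def
proof (intro conjI ballI impI)
  show "1 \<in> limit_set X"
    using one by (rule limit_setI) (rule tendsto_const)
next
  fix p q assume "p \<in> limit_set X" "q \<in> limit_set X" and norms: "heis_norm p < 1" "heis_norm q < 1"
  then obtain e f where e: "\<And>n. e n \<in> X n" "e \<longlonglongrightarrow> p" and f: "\<And>n. f n \<in> X n" "f \<longlonglongrightarrow> q"
    unfolding limit_set_def by blast
  \<comment> \<open>For the indices where an approximant is outside the unit ball, the point 1
    serves as a default for \<open>z n\<close>, so that the sequence stays in the sets
    throughout.\<close>
  have "\<exists>p' z. z \<in> X n \<and> (heis_norm (e n) < 1 \<longrightarrow> heis_norm (f n) < 1 \<longrightarrow>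
      dist p' (e n) < \<tau> n \<and> dist z (symmetric_point p' (f n)) < 2 * \<tau> n)" for n
  proof (cases "heis_norm (e n) < 1 \<and> heis_norm (f n) < 1")
    case True
    then show ?thesis
      using sym[OF e(1) _ f(1), of n] by (auto simp: dist_commute)
  qed (use one in blast)
  then obtain e' z where z: "\<And>n. z n \<in> X n"
    and near: "\<And>n. heis_norm (e n) < 1 \<Longrightarrow> heis_norm (f n) < 1 \<Longrightarrow>
      dist (e' n) (e n) < \<tau> n \<and> dist (z n) (symmetric_point (e' n) (f n)) < 2 * \<tau> n"
    by metis
  have ev: "\<forall>\<^sub>F n in sequentially. heis_norm (e n) < 1 \<and> heis_norm (f n) < 1"
    using order_tendstoD(2)[OF tendsto_heis_norm[OF e(2)] norms(1)]
      order_tendstoD(2)[OF tendsto_heis_norm[OF f(2)] norms(2)]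
    by (rule eventually_conj)
  have "(\<lambda>n. dist (e' n) (e n)) \<longlonglongrightarrow> 0"
    by (rule Lim_null_comparison[OF _ \<tau>], rule eventually_mono[OF ev])
      (use near in \<open>auto intro: less_imp_le\<close>)
  then have e': "e' \<longlonglongrightarrow> p"
    using e(2) by (rule tendsto_transform_dist)
  have "(\<lambda>n. 2 * \<tau> n) \<longlonglongrightarrow> 0"
    using tendsto_mult_left[OF \<tau>, of 2] by simp
  then have "(\<lambda>n. dist (z n) (symmetric_point (e' n) (f n))) \<longlonglongrightarrow> 0"
    by (rule Lim_null_comparison[rotated], intro eventually_mono[OF ev])
      (use near in \<open>auto intro: less_imp_le\<close>)
  then have "z \<longlonglongrightarrow> symmetric_point p q"
    using tendsto_symmetric_point[OF e' f(2)] by (rule tendsto_transform_dist)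
  with z show "symmetric_point p q \<in> limit_set X"
    by (rule limit_setI)
qed

text \<open>Finitely many strict inequalities between limits hold for the approximants at one common
  large index; the separation is halved to make it strict.\<close>

lemma limit_set_card_separated:
  fixes \<delta> B :: real
  assumes S: "finite S" "S \<subseteq> limit_set X" "\<And>q. q \<in> S \<Longrightarrow> heis_norm q < R"
    and sep: "\<And>x y. x \<in> S \<Longrightarrow> y \<in> S \<Longrightarrow> x \<noteq> y \<Longrightarrow> \<delta> \<le> dist x y"
    and "0 < \<delta>"
    and w: "w \<in> limit_set X" "M < heis_norm w"
  obtains n T v where "finite T" "T \<subseteq> X n" "card T = card S" "\<forall>q\<in>T. heis_norm q < R"
    "\<forall>x\<in>T. \<forall>y\<in>T. x \<noteq> y \<longrightarrow> \<delta> / 2 \<le> dist x y" "v \<in> X n" "M < heis_norm v"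
proof -
  obtain e where e: "\<And>s n. s \<in> S \<Longrightarrow> e s n \<in> X n" "\<And>s. s \<in> S \<Longrightarrow> e s \<longlonglongrightarrow> s"
    using S(2) by (metis limit_setE subsetD)
  obtain v where v: "\<And>n. v n \<in> X n" "v \<longlonglongrightarrow> w"
    using w(1) by (metis limit_setE)
  have ev_v: "\<forall>\<^sub>F n in sequentially. M < heis_norm (v n)"
    using tendsto_heis_norm[OF v(2)] w(2) by (rule order_tendstoD(1))
  have ev_norm: "\<forall>\<^sub>F n in sequentially. \<forall>s\<in>S. heis_norm (e s n) < R"
    using order_tendstoD(2)[OF tendsto_heis_norm[OF e(2)] S(3)] S(1)
    by (intro eventually_ball_finite) auto
  have ev_sep: "\<forall>\<^sub>F n in sequentially. \<forall>s\<in>S. \<forall>t\<in>S. s \<noteq> t \<longrightarrow> \<delta> / 2 < dist (e s n) (e t n)"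
  proof (intro eventually_ball_finite S(1) ballI)
    fix s t assume "s \<in> S" "t \<in> S"
    then have lim: "(\<lambda>n. dist (e s n) (e t n)) \<longlonglongrightarrow> dist s t"
      by (intro tendsto_dist e)
    show "\<forall>\<^sub>F n in sequentially. s \<noteq> t \<longrightarrow> \<delta> / 2 < dist (e s n) (e t n)"
    proof (cases "s = t")
      case False
      then have "\<delta> / 2 < dist s t"
        using sep[OF \<open>s \<in> S\<close> \<open>t \<in> S\<close>] \<open>0 < \<delta>\<close> by linarith
      from order_tendstoD(1)[OF lim this] show ?thesis
        by (rule eventually_mono) simp
    qed simp
  qed
  obtain n where n: "M < heis_norm (v n)" "\<forall>s\<in>S. heis_norm (e s n) < R"
    "\<forall>s\<in>S. \<forall>t\<in>S. s \<noteq> t \<longrightarrow> \<delta> / 2 < dist (e s n) (e t n)"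
    using eventually_happens[OF eventually_conj[OF ev_v eventually_conj[OF ev_norm ev_sep]]] by auto
  have "inj_on (\<lambda>s. e s n) S"
    using n(3) \<open>0 < \<delta>\<close> by (intro inj_onI) (fastforce dest: bspec)
  then have card: "card ((\<lambda>s. e s n) ` S) = card S"
    by (rule card_image)
  show ?thesis
  proof (rule that[of "(\<lambda>s. e s n) ` S" n "v n"])
    show "\<forall>x\<in>(\<lambda>s. e s n) ` S. \<forall>y\<in>(\<lambda>s. e s n) ` S. x \<noteq> y \<longrightarrow> \<delta> / 2 \<le> dist x y"
      using n(3) by (fastforce intro: less_imp_le)
  qed (use S(1) e(1) card n v in auto)
qed

text \<open>
  Contradiction and compactness: rescaled counterexamples with \<open>\<tau> = 1/(n+1)\<close> have a limit set that
  is exactly symmetric, yet contains two points spanning a plane, one of them much closer to the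
  origin than the other.
\<close>

lemma symmetric_imp_flat:
  fixes \<epsilon> A :: real
  assumes "0 < \<epsilon>" and A: "1 \<le> A"
  defines "c \<equiv> 1 / (2 ^ 29 * A\<^sup>2)"
  shows "\<exists>\<tau>>0. \<forall>E p r. three_regular A E \<longrightarrow> p \<in> E \<longrightarrow> 0 < r \<longrightarrow>
    symmetric_in_ball \<tau> E p r \<longrightarrow> vertical_beta E p (c * r) < ennreal \<epsilon>"
proof (rule ccontr)
  assume no: "\<not> ?thesis"
  have A2: "1 \<le> A\<^sup>2"
    using A by (simp add: one_le_power)
  have c: "0 < c" "c \<le> 1 / 100" "2 ^ 29 * c * A\<^sup>2 = 1"
    using A2 by (auto simp: c_def divide_simps)
  \<comment> \<open>The transversality left by non-flatness at radius \<open>c * r n\<close> once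
    everything is rescaled to unit size.\<close>
  define \<eta> where "\<eta> = \<epsilon> / 2 * c"
  have \<eta>: "0 < \<eta>"
    using \<open>0 < \<epsilon>\<close> c by (simp add: \<eta>_def)
  \<comment> \<open>The first point is sought within \<open>\<rho>\<close>: then 4|a| is at most
    \<open>\<eta>\<close>, which gives the condition 4|a|^2 \<le> \<omega> of
    \<open>unit_symmetric_many_points\<close>.\<close>
  define \<rho> where "\<rho> = min (\<eta> / 4) (1 / 100)"
  have \<rho>: "0 < \<rho>" "4 * \<rho> \<le> \<eta>" "\<rho> \<le> 1 / 100"
    using \<eta> by (auto simp: \<rho>_def min_def)
  define \<kappa> where "\<kappa> = \<rho> / (200 * A\<^sup>2)"
  have \<kappa>: "0 < \<kappa>"
    using \<rho> A by (simp add: \<kappa>_def)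
  define \<tau> where "\<tau> = (\<lambda>n. inverse (real (Suc n)))"
  have \<tau>: "0 < \<tau> n" for n
    by (simp add: \<tau>_def)
  have "\<tau> \<longlonglongrightarrow> 0"
    unfolding \<tau>_def by (rule LIMSEQ_inverse_real_of_nat)
  have "\<exists>E p r. three_regular A E \<and> p \<in> E \<and> 0 < r \<and> symmetric_in_ball (\<tau> n) E p r \<and>
      ennreal \<epsilon> \<le> vertical_beta E p (c * r)" for n
    using no \<tau>[of n] by (meson not_le)
  then obtain E p r where reg: "\<And>n. three_regular A (E n)" and p: "\<And>n. p n \<in> E n"
    and r: "\<And>n. 0 < r n" and sym: "\<And>n. symmetric_in_ball (\<tau> n) (E n) (p n) (r n)"
    and beta: "\<And>n. ennreal \<epsilon> \<le> vertical_beta (E n) (p n) (c * r n)"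
    by metis
  define X where "X n = {q. rescale (p n) (r n) q \<in> E n}" for n
  have X_far: "\<exists>b\<in>X n. heis_norm b < c \<and> \<eta> * norm (heis_proj a) \<le> \<bar>heis_cross a b\<bar>"
    if a: "heis_proj a \<noteq> 0" for n a
  proof -
    have "0 < c * r n"
      using c r by simp
    from vertical_beta_far_point[OF \<open>0 < \<epsilon>\<close> this beta a] obtain y
      where y: "p n * y \<in> E n" "heis_norm y < c * r n"
        "\<epsilon> / 2 * (c * r n) * norm (heis_proj a) \<le> \<bar>heis_cross a y\<bar>" .
    obtain b where b: "y = heis_dil (r n) b"
      using rescale_surj[OF r, of y 1] by (metis mult_1_left rescale_def)
    have "heis_cross a y = r n * heis_cross a b"
      unfolding b by (cases a; cases b) (simp add: algebra_simps)
    then have "r n * (\<eta> * norm (heis_proj a)) \<le> r n * \<bar>heis_cross a b\<bar>"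
      using y(3) r[of n] by (simp add: \<eta>_def abs_mult algebra_simps)
    moreover have "b \<in> X n"
      using y(1) by (simp add: X_def rescale_def b)
    moreover have "r n * heis_norm b < r n * c"
      using y(2) r[of n] by (simp add: b heis_norm_dil mult.commute)
    ultimately show ?thesis
      using r[of n] by (intro bexI[of _ b]) auto
  qed
  have X_near: "\<exists>a\<in>X n. heis_norm a \<le> \<rho> \<and> \<kappa> \<le> norm (heis_proj a)" for n
  proof -
    \<comment> \<open>Non-flatness, tested in an arbitrary direction, supplies a point of
      \<open>E n\<close> at distance at least \<open>r n * \<rho>\<close>, so the radius is
      admissible for the regularity bounds.\<close>
    have "r n * \<rho> \<le> diameter (E n)" if bd: "bounded (E n)"
    proof -
      obtain b where b: "b \<in> X n" "\<eta> * norm (heis_proj (Heis (1, 0, 0))) \<le> \<bar>heis_cross (Heis (1, 0, 0)) b\<bar>"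
        using X_far[of "Heis (1, 0, 0)" n] by (auto simp: zero_prod_def)
      have "\<rho> \<le> \<bar>heis_cross (Heis (1, 0, 0)) b\<bar>"
        using b(2) \<rho> by (simp add: norm_Pair)
      also have "\<dots> \<le> norm (heis_proj b)"
        by (cases b) (simp add: norm_Pair)
      also have "\<dots> \<le> heis_norm b"
        by (rule norm_heis_proj_le)
      finally have "r n * \<rho> \<le> dist (p n) (rescale (p n) (r n) b)"
        using r[of n] by (simp add: dist_rescale_center)
      also have "\<dots> \<le> diameter (E n)"
        using bd p b(1) by (intro diameter_bounded_bound) (auto simp: X_def)
      finally show ?thesis .
    qed
    from three_regular_not_vertical[OF reg p _ this] obtain x
      where x: "x \<in> E n" "dist (p n) x < r n * \<rho>"
        "r n * \<rho> / (200 * A\<^sup>2) \<le> norm (heis_proj x - heis_proj (p n))"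
      using r[of n] \<rho> by auto
    obtain a where a: "x = rescale (p n) (r n) a"
      using rescale_surj[OF r, of x] .
    have "heis_proj x - heis_proj (p n) = r n *\<^sub>R heis_proj a"
      unfolding a rescale_def by (cases "p n"; cases a) simp
    then have "r n * \<kappa> \<le> r n * norm (heis_proj a)"
      using x(3) r[of n] by (simp add: \<kappa>_def)
    moreover have "r n * heis_norm a \<le> r n * \<rho>"
      using x(2) r[of n] by (simp add: a dist_rescale_center)
    ultimately show ?thesis
      using x(1) r[of n] by (intro bexI[of _ a]) (auto simp: X_def a)
  qed
  have "\<exists>a b. a \<in> X n \<and> heis_norm a \<le> \<rho> \<and> \<kappa> \<le> norm (heis_proj a) \<and>
      b \<in> X n \<and> heis_norm b \<le> c \<and> \<eta> * norm (heis_proj a) \<le> \<bar>heis_cross a b\<bar>" for n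
  proof -
    obtain a where a: "a \<in> X n" "heis_norm a \<le> \<rho>" "\<kappa> \<le> norm (heis_proj a)"
      using X_near by blast
    then have "heis_proj a \<noteq> 0"
      using \<kappa> by auto
    from X_far[OF this, of n] a show ?thesis
      by (meson less_imp_le)
  qed
  then obtain a b where a: "\<And>n. a n \<in> X n" "\<And>n. heis_norm (a n) \<le> \<rho>" "\<And>n. \<kappa> \<le> norm (heis_proj (a n))"
    and b: "\<And>n. b n \<in> X n" "\<And>n. heis_norm (b n) \<le> c"
    and ab: "\<And>n. \<eta> * norm (heis_proj (a n)) \<le> \<bar>heis_cross (a n) (b n)\<bar>"
    by metis
  \<comment> \<open>The limit set is formed along a subsequence on which both points converge, so it
    contains both limits. The bounds by \<open>\<kappa>\<close> and \<open>\<eta>\<close> keep the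
    limits transversal.\<close>
  obtain a\<^sub>0 \<sigma>\<^sub>1 where \<sigma>\<^sub>1: "strict_mono \<sigma>\<^sub>1" "(a \<circ> \<sigma>\<^sub>1) \<longlonglongrightarrow> a\<^sub>0"
    using heis_bounded_subseq[OF a(2)] .
  have "heis_norm ((b \<circ> \<sigma>\<^sub>1) n) \<le> c" for n
    using b(2) by simp
  then obtain b\<^sub>0 \<sigma>\<^sub>2 where \<sigma>\<^sub>2: "strict_mono \<sigma>\<^sub>2" "((b \<circ> \<sigma>\<^sub>1) \<circ> \<sigma>\<^sub>2) \<longlonglongrightarrow> b\<^sub>0"
    by (rule heis_bounded_subseq)
  define \<sigma> where "\<sigma> = \<sigma>\<^sub>1 \<circ> \<sigma>\<^sub>2"
  have \<sigma>: "strict_mono \<sigma>"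
    unfolding \<sigma>_def using \<sigma>\<^sub>1(1) \<sigma>\<^sub>2(1) by (rule strict_mono_o)
  have a_lim: "(\<lambda>n. a (\<sigma> n)) \<longlonglongrightarrow> a\<^sub>0"
    using LIMSEQ_subseq_LIMSEQ[OF \<sigma>\<^sub>1(2) \<sigma>\<^sub>2(1)] by (simp add: \<sigma>_def comp_def)
  have b_lim: "(\<lambda>n. b (\<sigma> n)) \<longlonglongrightarrow> b\<^sub>0"
    using \<sigma>\<^sub>2(2) by (simp add: \<sigma>_def comp_def)
  define F where "F = limit_set (\<lambda>n. X (\<sigma> n))"
  have F: "unit_symmetric F"
    unfolding F_def
  proof (rule unit_symmetric_limit_set)
    show "1 \<in> X (\<sigma> n)" for n
      using p by (simp add: X_def rescale_one)
    show "(\<lambda>n. \<tau> (\<sigma> n)) \<longlonglongrightarrow> 0"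
      using LIMSEQ_subseq_LIMSEQ[OF \<open>\<tau> \<longlonglongrightarrow> 0\<close> \<sigma>] by (simp add: comp_def)
    show "\<exists>p' z. dist p' x < \<tau> (\<sigma> n) \<and> z \<in> X (\<sigma> n) \<and> dist (symmetric_point p' y) z < 2 * \<tau> (\<sigma> n)"
      if "x \<in> X (\<sigma> n)" "heis_norm x < 1" "y \<in> X (\<sigma> n)" "heis_norm y < 1" for n x y
      using rescale_symmetric[OF sym \<tau> r] that unfolding X_def by blast
  qed
  have a\<^sub>0: "a\<^sub>0 \<in> F" "heis_norm a\<^sub>0 \<le> \<rho>" "\<kappa> \<le> norm (heis_proj a\<^sub>0)"
    unfolding F_def using a
    by (auto intro: limit_setI[OF _ a_lim] tendsto_upperbound[OF tendsto_heis_norm[OF a_lim]]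
        tendsto_lowerbound[OF tendsto_norm[OF tendsto_heis_proj[OF a_lim]]])
  have b\<^sub>0: "b\<^sub>0 \<in> F" "heis_norm b\<^sub>0 \<le> c"
    unfolding F_def using b
    by (auto intro: limit_setI[OF _ b_lim] tendsto_upperbound[OF tendsto_heis_norm[OF b_lim]])
  have ab\<^sub>0: "\<eta> * norm (heis_proj a\<^sub>0) \<le> \<bar>heis_cross a\<^sub>0 b\<^sub>0\<bar>"
    by (rule tendsto_le[OF _ tendsto_rabs[OF tendsto_heis_cross[OF a_lim b_lim]]
          tendsto_mult_left[OF tendsto_norm[OF tendsto_heis_proj[OF a_lim]]]])
      (use ab in auto)
  \<comment> \<open>Reflection in the origin, if necessary, makes the determinant
    nonnegative.\<close>
  obtain b\<^sub>1 where b\<^sub>1: "b\<^sub>1 \<in> F" "heis_norm b\<^sub>1 \<le> c" "heis_cross a\<^sub>0 b\<^sub>1 = \<bar>heis_cross a\<^sub>0 b\<^sub>0\<bar>"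
  proof (cases "0 \<le> heis_cross a\<^sub>0 b\<^sub>0")
    case True
    then show ?thesis
      using b\<^sub>0 that by simp
  next
    case False
    have "symmetric_point 1 b\<^sub>0 \<in> F"
      using F b\<^sub>0 c unfolding unit_symmetric_def by (auto simp: dist_heis_one[symmetric])
    moreover have "heis_norm (symmetric_point 1 b\<^sub>0) = heis_norm b\<^sub>0"
      by (cases b\<^sub>0) (simp add: one_heis_def symmetric_point_Heis)
    moreover have "heis_cross a\<^sub>0 (symmetric_point 1 b\<^sub>0) = - heis_cross a\<^sub>0 b\<^sub>0"
      by (cases a\<^sub>0; cases b\<^sub>0) (simp add: one_heis_def symmetric_point_Heis)
    ultimately show ?thesis
      using b\<^sub>0(2) False that by auto
  qed
  obtain u\<^sub>1 u\<^sub>2 \<alpha> where u: "a\<^sub>0 = Heis (u\<^sub>1, u\<^sub>2, \<alpha>)"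
    by (cases a\<^sub>0)
  obtain v\<^sub>1 v\<^sub>2 \<beta> where v: "b\<^sub>1 = Heis (v\<^sub>1, v\<^sub>2, \<beta>)"
    by (cases b\<^sub>1)
  define \<omega> where "\<omega> = u\<^sub>1 * v\<^sub>2 - u\<^sub>2 * v\<^sub>1"
  have \<omega>_ge: "\<eta> * norm (u\<^sub>1, u\<^sub>2) \<le> \<omega>"
    using ab\<^sub>0 b\<^sub>1(3) by (simp add: u v \<omega>_def)
  have nu: "\<kappa> \<le> norm (u\<^sub>1, u\<^sub>2)" "norm (u\<^sub>1, u\<^sub>2) \<le> \<rho>"
    using a\<^sub>0 norm_heis_proj_le[of a\<^sub>0] by (simp_all add: u)
  have "0 < \<eta> * norm (u\<^sub>1, u\<^sub>2)"
    using \<eta> \<kappa> nu(1) by (intro mult_pos_pos) auto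
  then have \<omega>_pos: "0 < \<omega>"
    using \<omega>_ge by linarith
  have "4 * norm (u\<^sub>1, u\<^sub>2) * norm (u\<^sub>1, u\<^sub>2) \<le> \<eta> * norm (u\<^sub>1, u\<^sub>2)"
    using nu \<rho> by (intro mult_right_mono) auto
  then have \<omega>_sq: "4 * (norm (u\<^sub>1, u\<^sub>2))\<^sup>2 \<le> \<omega>"
    using \<omega>_ge by (simp add: power2_eq_square)
  have na: "heis_norm a\<^sub>0 \<le> 1 / 100"
    using a\<^sub>0 \<rho> by linarith
  obtain S and \<delta> :: real and w where S: "finite S" "S \<subseteq> F" "\<forall>q\<in>S. heis_norm q \<le> 1 / 32"
    and \<delta>: "0 < \<delta>" "\<delta> \<le> 1 / 16" and sep: "\<forall>x\<in>S. \<forall>y\<in>S. x \<noteq> y \<longrightarrow> \<delta> \<le> dist x y"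
    and many: "1 < 2 ^ 29 * c * (card S * \<delta> ^ 3)" and w: "w \<in> F" "1 / 8 < heis_norm w"
    by (rule unit_symmetric_many_points[OF F a\<^sub>0(1)[unfolded u] na[unfolded u]
          b\<^sub>1(1)[unfolded v] b\<^sub>1(2)[unfolded v] c(1,2) \<omega>_def \<omega>_pos \<omega>_sq])
  have S': "heis_norm q < 1 / 16" if "q \<in> S" for q
    using bspec[OF S(3) that] by simp
  have sep': "\<delta> \<le> dist x y" if "x \<in> S" "y \<in> S" "x \<noteq> y" for x y
    using sep that by simp
  obtain n T z where T: "finite T" "T \<subseteq> X (\<sigma> n)" "card T = card S" "\<forall>q\<in>T. heis_norm q < 1 / 16"
    and sepT: "\<forall>x\<in>T. \<forall>y\<in>T. x \<noteq> y \<longrightarrow> \<delta> / 2 \<le> dist x y"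
    and z: "z \<in> X (\<sigma> n)" "1 / 8 < heis_norm z"
    by (rule limit_set_card_separated[OF S(1) S(2)[unfolded F_def] S' sep' \<delta>(1) w(1)[unfolded F_def] w(2)])
  \<comment> \<open>The halved separation costs a factor 8, which the bound
    \<open>A\<^sup>2 / 8\<close> compensates. The value of \<open>c\<close> was chosen to make the
    resulting upper bound for the count equal to one.\<close>
  have "card T * (\<delta> / 2) ^ 3 \<le> A\<^sup>2 / 8"
    by (rule rescale_card_separated[OF reg p r, where w = z])
      (use T sepT z \<delta> in \<open>auto simp: X_def\<close>)
  then have "card S * \<delta> ^ 3 \<le> A\<^sup>2"
    by (simp add: T(3) power_divide)
  then have "2 ^ 29 * c * (card S * \<delta> ^ 3) \<le> 2 ^ 29 * c * A\<^sup>2"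
    using c(1) by (intro mult_left_mono) auto
  with many c(3) show False
    by linarith
qed


section \<open>Integration over scales\<close>

text \<open>
  The integrand need not be measurable in the scale, so the substitution rule is applied to the
  simple functions below it.
\<close>

lemma nn_integral_lborel_rescale_le:
  fixes h :: "real \<Rightarrow> ennreal"
  assumes "0 < k"
  shows "(\<integral>\<^sup>+ r. h (r / k) / ennreal k \<partial>lborel) \<le> (\<integral>\<^sup>+ s. h s \<partial>lborel)"
  unfolding nn_integral_def[of lborel "\<lambda>r. h (r / k) / ennreal k"]
proof (rule SUP_least)
  fix g :: "real \<Rightarrow> ennreal"
  assume "g \<in> {g. simple_function lborel g \<and> g \<le> (\<lambda>r. h (r / k) / ennreal k)}"
  then have g: "simple_function lborel g" and le: "\<And>r. g r \<le> h (r / k) / ennreal k"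
    by (auto simp: le_fun_def)
  have meas: "g \<in> borel_measurable borel"
    using borel_measurable_simple_function[OF g] by simp
  have "integral\<^sup>S lborel g = (\<integral>\<^sup>+ r. g r \<partial>lborel)"
    using g by (rule nn_integral_eq_simple_integral[symmetric])
  also have "\<dots> = ennreal \<bar>k\<bar> * (\<integral>\<^sup>+ s. g (0 + k * s) \<partial>lborel)"
    using meas assms by (intro nn_integral_real_affine) auto
  also have "\<dots> = (\<integral>\<^sup>+ s. ennreal k * g (k * s) \<partial>lborel)"
    using meas assms by (subst nn_integral_cmult) auto
  also have "\<dots> \<le> (\<integral>\<^sup>+ s. h s \<partial>lborel)"
  proof (rule nn_integral_mono)
    fix s
    have "ennreal k * g (k * s) \<le> ennreal k * (h (k * s / k) / ennreal k)"
      by (intro mult_left_mono le) simp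
    also have "\<dots> = h s"
      using assms ennreal_mult_divide_eq[of "ennreal k" "h s"]
      by (simp add: ennreal_times_divide mult.commute[of "ennreal k"])
    finally show "ennreal k * g (k * s) \<le> h s" .
  qed
  finally show "integral\<^sup>S lborel g \<le> (\<integral>\<^sup>+ s. h s \<partial>lborel)" .
qed

text \<open>The measure dr/r is invariant under dilations: the factor \<open>k\<close> from the
  substitution cancels against that of the denominator.\<close>

lemma nn_integral_log_scale_le:
  fixes f :: "real \<Rightarrow> ennreal"
  assumes "0 < k"
  shows "(\<integral>\<^sup>+ r\<in>{0<..<R}. f (r / k) / ennreal r \<partial>lborel) \<le>
    (\<integral>\<^sup>+ s\<in>{0<..<R / k}. f s / ennreal s \<partial>lborel)"
proof -
  define h where "h s = f s / ennreal s * indicator {0<..<R / k} s" for s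
  have "f (r / k) / ennreal r * indicator {0<..<R} r = h (r / k) / ennreal k" for r
  proof (cases "r \<in> {0<..<R}")
    case True
    then have "ennreal r = ennreal (r / k) * ennreal k"
      using assms by (simp flip: ennreal_mult)
    then have "f (r / k) / ennreal r = f (r / k) / ennreal (r / k) / ennreal k"
      using assms True by (simp add: divide_ennreal_def ennreal_inverse_mult mult.assoc)
    with True assms show ?thesis
      by (simp add: h_def divide_strict_right_mono)
  next
    case False
    then have "r / k \<notin> {0<..<R / k}"
      using assms by (auto simp: zero_less_divide_iff divide_less_cancel)
    with False show ?thesis
      by (simp add: h_def)
  qed
  then show ?thesis
    using nn_integral_lborel_rescale_le[OF assms, of h] by (simp add: h_def)
qed

theorem proposition3p6:
  fixes \<epsilon> A :: real and c :: "real \<Rightarrow> real"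
  assumes "\<epsilon> > 0" and "A \<ge> 1" and "\<And>\<tau>. \<tau> > 0 \<Longrightarrow> c \<tau> > 0"
  shows "\<exists>C\<ge>1. \<forall>E :: heis set.
    closed E \<longrightarrow> three_regular A E \<longrightarrow> local_symmetry c E \<longrightarrow>
    (\<forall>p\<^sub>0\<in>E. \<forall>R>0.
       (\<integral>\<^sup>+ r \<in> {0<..<R}.
          hausdorff_measure 3 {p \<in> E \<inter> ball p\<^sub>0 R. vertical_beta E p r \<ge> ennreal \<epsilon>} / ennreal r
          \<partial>lborel)
       \<le> ennreal (C * R ^ 3))"
proof -
  define k where "k = 1 / (2 ^ 29 * A\<^sup>2)"
  obtain \<tau> where "0 < \<tau>" and flat: "\<And>E p r. three_regular A E \<Longrightarrow> p \<in> E \<Longrightarrow> 0 < r \<Longrightarrow>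
      symmetric_in_ball \<tau> E p r \<Longrightarrow> vertical_beta E p (k * r) < ennreal \<epsilon>"
    using symmetric_imp_flat[OF assms(1,2)] unfolding k_def by blast
  have "1 \<le> A\<^sup>2"
    using assms(2) by (simp add: one_le_power)
  then have k: "0 < k" "k \<le> 1"
    by (auto simp: k_def divide_simps)
  \<comment> \<open>The substitution enlarges the radius from \<open>R\<close> to
    \<open>R / k\<close>, which costs \<open>1 / k ^ 3\<close>.\<close>
  define C where "C = max 1 (c \<tau> / k ^ 3)"
  show ?thesis
  proof (intro exI[of _ C] conjI allI impI ballI)
    show "1 \<le> C"
      by (simp add: C_def)
    fix E :: "heis set" and p\<^sub>0 and R :: real
    assume reg: "three_regular A E" and sym: "local_symmetry c E" and p\<^sub>0: "p\<^sub>0 \<in> E" and R: "0 < R"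
    have "R * k \<le> R * 1"
      using k R by (intro mult_left_mono) auto
    then have R_le: "R \<le> R / k"
      using k by (simp add: field_simps)
    \<comment> \<open>The ball has radius \<open>R / k\<close> to match the range of the substituted
      scales, as the symmetry condition uses the same radius for both.\<close>
    define bad where
      "bad r = hausdorff_measure 3 {p \<in> E \<inter> ball p\<^sub>0 (R / k). \<not> symmetric_in_ball \<tau> E p r}" for r
    \<comment> \<open>Contrapositive of flatness: a point that is bad for beta at scale
      \<open>r\<close> is bad for symmetry at scale \<open>r / k\<close>.\<close>
    have "hausdorff_measure 3 {p \<in> E \<inter> ball p\<^sub>0 R. ennreal \<epsilon> \<le> vertical_beta E p r} \<le> bad (r / k)"
      if "r \<in> {0<..<R}" for r
      unfolding bad_def
    proof (rule hausdorff_measure_mono, safe)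
      fix p assume p: "p \<in> E" "p \<in> ball p\<^sub>0 R" "ennreal \<epsilon> \<le> vertical_beta E p r"
        and "symmetric_in_ball \<tau> E p (r / k)"
      then have "vertical_beta E p (k * (r / k)) < ennreal \<epsilon>"
        using that k by (intro flat reg) auto
      with p(3) k show False
        by simp
    qed (use R_le in auto)
    then have "(\<integral>\<^sup>+ r \<in> {0<..<R}.
          hausdorff_measure 3 {p \<in> E \<inter> ball p\<^sub>0 R. vertical_beta E p r \<ge> ennreal \<epsilon>} / ennreal r
          \<partial>lborel) \<le> (\<integral>\<^sup>+ r\<in>{0<..<R}. bad (r / k) / ennreal r \<partial>lborel)"
      by (intro nn_integral_mono) (auto simp: indicator_def intro!: divide_right_mono_ennreal)
    also have "\<dots> \<le> (\<integral>\<^sup>+ s\<in>{0<..<R / k}. bad s / ennreal s \<partial>lborel)"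
      using k(1) by (rule nn_integral_log_scale_le)
    also have "\<dots> \<le> ennreal (c \<tau> * (R / k) ^ 3)"
      using sym p\<^sub>0 R k \<open>0 < \<tau>\<close> unfolding local_symmetry_def bad_def by simp
    also have "\<dots> \<le> ennreal (C * R ^ 3)"
    proof (rule ennreal_leI)
      have "c \<tau> * (R / k) ^ 3 = c \<tau> / k ^ 3 * R ^ 3"
        by (simp add: power_divide)
      also have "\<dots> \<le> C * R ^ 3"
        using R by (intro mult_right_mono) (auto simp: C_def)
      finally show "c \<tau> * (R / k) ^ 3 \<le> C * R ^ 3" .
    qed
    finally show "(\<integral>\<^sup>+ r \<in> {0<..<R}.
          hausdorff_measure 3 {p \<in> E \<inter> ball p\<^sub>0 R. vertical_beta E p r \<ge> ennreal \<epsilon>} / ennreal r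
          \<partial>lborel) \<le> ennreal (C * R ^ 3)" .
  qed
qed

end
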